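(* Let $K$ be an algebraically closed field, let $m,n\ge 1$ and $d\ge 0$ be integers. The variety ${\rm H}_{d,n}^{(m)}$ has a cell decomposition whose cells are parametrized by the set ${\cal F}_{d,n}^{(m)}$ of $m$-ary forests with $n$ roots and $d$ nodes.
   Context: The variety ${\rm H}_{d,n}^{(m)}$: let $W$, $V$ be $K$-vector spaces of dimensions $d$ and $n$. The group ${\rm GL}(W)$ acts on $X={\rm Hom}(V,W)\oplus{\rm End}(W)^m$ by $g(f,\varphi_1,\ldots,\varphi_m)=(gf,g\varphi_1g^{-1},\ldots,g\varphi_mg^{-1})$. A tuple $(f,\varphi_* )=(f,\varphi_1,\ldots,\varphi_m)\in X$ is called stable if $K\langle\varphi_1,\ldots,\varphi_m\rangle f(V)=W$, i.e. the smallest subspace of $W$ containing $f(V)$ and invariant under all $\varphi_i$ is $W$. Let $X^s\subset X$ be the open subset of stable tuples; stabilizers of stable tuples are trivial, and ${\rm H}_{d,n}^{(m)}=X^s/{\rm GL}(W)$ is the (geometric) quotient variety; it is smooth and irreducible of dimension $nd+(m-1)d^2$ whenever nonempty. Forests: let $\Omega$ be the set of finite words in the alphabet $\{1,\ldots,m\}$. An $m$-ary tree is a (possibly empty) finite subset $S\subset\Omega$ closed under taking left subwords: if $ww'\in S$ then $w\in S$. An $m$-ary forest with $n$ roots is an $n$-tuple $S_*=(S_1,\ldots,S_n)$ of $m$-ary trees; its number of nodes is $|S_*|=\sum_{i=1}^n|S_i|$. ${\cal F}_{d,n}^{(m)}$ denotes the (finite) set of $m$-ary forests with $n$ roots and $d$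 nodes. Cell decomposition: a variety $Y$ has a cell decomposition if there is a finite filtration $Y=A_1\supset A_2\supset\cdots\supset A_u\supset A_{u+1}=\emptyset$ by closed subvarieties such that each successive complement $A_i\setminus A_{i+1}$ is isomorphic to an affine space; these complements are the cells. *)

theory Defs
  imports
    "HOL-Analysis.Abstract_Topology"
    "HOL-Algebra.Group_Action"
    "HOL-Computational_Algebra.Polynomial"
    "Jordan_Normal_Form.VS_Connect"
begin

text \<open>
  Varieties over the algebraically closed field \<open>'k\<close> are treated in the classical way, as
  topological spaces together with, for every open set \<open>U\<close>, the set of \<open>'k\<close>-valued regular
  functions on \<open>U\<close>. Functions are total in HOL: \<open>f \<in> reg S U\<close> depends only on the values
  of \<open>f\<close> on \<open>U\<close>, and \<open>reg S U\<close> is only meaningful if \<open>U\<close> is open in \<open>topo S\<close>.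
\<close>

record ('p, 'k) fspace =
  topo :: "'p topology"
  reg :: "'p set \<Rightarrow> ('p \<Rightarrow> 'k) set"

text \<open>
  An isomorphism is a homeomorphism for which pulling back along it matches the regular
  functions on each open set. As it is bijective, the equivalence below says that both it and
  its inverse are morphisms.
\<close>

definition fspace_iso :: "('p, 'k) fspace \<Rightarrow> ('q, 'k) fspace \<Rightarrow> ('p \<Rightarrow> 'q) \<Rightarrow> bool" where
  "fspace_iso S T h \<longleftrightarrow>
     homeomorphic_map (topo S) (topo T) h \<and>
     (\<forall>V f. openin (topo T) V \<longrightarrow>
        (f \<in> reg T V \<longleftrightarrow> f \<circ> h \<in> reg S {x \<in> topspace (topo S). h x \<in> V}))"

definition isomorphic_fspaces :: "('p, 'k) fspace \<Rightarrow> ('q, 'k) fspace \<Rightarrow> bool" where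
  "isomorphic_fspaces S T \<longleftrightarrow> (\<exists>h. fspace_iso S T h)"

text \<open>Polynomial functions in a given set \<open>C\<close> of coordinate functions.\<close>

inductive_set poly_funs :: "('p \<Rightarrow> 'k::comm_ring_1) set \<Rightarrow> ('p \<Rightarrow> 'k) set"
  for C :: "('p \<Rightarrow> 'k) set" where
  const: "(\<lambda>_. c) \<in> poly_funs C"
| coord: "f \<in> C \<Longrightarrow> f \<in> poly_funs C"
| add: "f \<in> poly_funs C \<Longrightarrow> g \<in> poly_funs C \<Longrightarrow> (\<lambda>x. f x + g x) \<in> poly_funs C"
| mult: "f \<in> poly_funs C \<Longrightarrow> g \<in> poly_funs C \<Longrightarrow> (\<lambda>x. f x * g x) \<in> poly_funs C"

text \<open>The open sets are the complements in \<open>X\<close> of the zero loci of sets \<open>P\<close> of polynomials.\<close>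

definition zariski_topology :: "'p set \<Rightarrow> ('p \<Rightarrow> 'k::field) set \<Rightarrow> 'p topology" where
  "zariski_topology X C =
     topology (\<lambda>U. \<exists>P \<subseteq> poly_funs C. U = {x \<in> X. \<exists>p\<in>P. p x \<noteq> 0})"

lemma istopology_zariski:
  fixes C :: "('p \<Rightarrow> 'k::field) set"
  shows "istopology (\<lambda>U. \<exists>P \<subseteq> poly_funs C. U = {x \<in> X. \<exists>p\<in>P. p x \<noteq> 0})"
proof (unfold istopology_def, intro conjI allI impI)
  fix S T
  assume "\<exists>P \<subseteq> poly_funs C. S = {x \<in> X. \<exists>p\<in>P. p x \<noteq> 0}"
    and "\<exists>P \<subseteq> poly_funs C. T = {x \<in> X. \<exists>p\<in>P. p x \<noteq> 0}"
  then obtain P Q where P: "P \<subseteq> poly_funs C" "S = {x \<in> X. \<exists>p\<in>P. p x \<noteq> 0}"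
    and Q: "Q \<subseteq> poly_funs C" "T = {x \<in> X. \<exists>p\<in>Q. p x \<noteq> 0}"
    by (elim exE conjE)
  let ?R = "(\<lambda>(p, q) x. p x * q x) ` (P \<times> Q)"
  have "?R \<subseteq> poly_funs C"
    using P(1) Q(1) by (auto intro: poly_funs.mult)
  moreover have "(\<exists>p\<in>P. p x \<noteq> 0) \<and> (\<exists>q\<in>Q. q x \<noteq> 0) \<longleftrightarrow> (\<exists>r\<in>?R. r x \<noteq> 0)" for x
    by (simp add: case_prod_beta Bex_def) (intro iffI; elim exE conjE; intro exI conjI; assumption)
  then have "S \<inter> T = {x \<in> X. \<exists>r\<in>?R. r x \<noteq> 0}"
    unfolding P(2) Q(2) by blast
  ultimately show "\<exists>R \<subseteq> poly_funs C. S \<inter> T = {x \<in> X. \<exists>p\<in>R. p x \<noteq> 0}"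
    by blast
next
  fix K
  assume "\<forall>S\<in>K. \<exists>P \<subseteq> poly_funs C. S = {x \<in> X. \<exists>p\<in>P. p x \<noteq> 0}"
  from bchoice[OF this] obtain P where
    P: "\<forall>S\<in>K. P S \<subseteq> poly_funs C \<and> S = {x \<in> X. \<exists>p\<in>P S. p x \<noteq> 0}" ..
  have P1: "P S \<subseteq> poly_funs C" if "S \<in> K" for S
    using bspec[OF P that] ..
  have P2: "x \<in> S \<longleftrightarrow> x \<in> X \<and> (\<exists>p\<in>P S. p x \<noteq> 0)" if "S \<in> K" for S x
  proof -
    have "S = {x \<in> X. \<exists>p\<in>P S. p x \<noteq> 0}"
      using bspec[OF P that] ..
    from arg_cong[OF this, of "\<lambda>A. x \<in> A"] show ?thesis
      by simp
  qed
  have "(\<Union>S\<in>K. P S) \<subseteq> poly_funs C"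
    using P1 by blast
  moreover have "\<Union>K = {x \<in> X. \<exists>p\<in>(\<Union>S\<in>K. P S). p x \<noteq> 0}"
    by (auto simp: P2) (rule bexI, rule bexI, assumption+)+
  ultimately show "\<exists>R \<subseteq> poly_funs C. \<Union>K = {x \<in> X. \<exists>p\<in>R. p x \<noteq> 0}"
    by blast
qed

lemma openin_zariski_topology:
  "openin (zariski_topology X C) U \<longleftrightarrow>
     (\<exists>P \<subseteq> poly_funs C. U = {x \<in> X. \<exists>p\<in>P. p x \<noteq> 0})"
  unfolding zariski_topology_def by (simp add: istopology_zariski)

lemma topspace_zariski_topology: "topspace (zariski_topology X C) = X"
proof -
  have "openin (zariski_topology X C) X"
    unfolding openin_zariski_topology
    by (intro exI[of _ "{\<lambda>_. 1}"]) (auto intro: poly_funs.const)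
  moreover have "U \<subseteq> X" if "openin (zariski_topology X C) U" for U
    using that unfolding openin_zariski_topology by auto
  ultimately show ?thesis
    by (simp add: openin_subset subset_antisym)
qed

text \<open>Regular functions are those that are locally quotients of polynomials.\<close>

definition zariski_space :: "'p set \<Rightarrow> ('p \<Rightarrow> 'k::field) set \<Rightarrow> ('p, 'k) fspace" where
  "zariski_space X C =
     \<lparr> topo = zariski_topology X C,
       reg = (\<lambda>U. {f. \<forall>x\<in>U. \<exists>V p q.
                 openin (zariski_topology X C) V \<and> x \<in> V \<and> V \<subseteq> U \<and>
                 p \<in> poly_funs C \<and> q \<in> poly_funs C \<and>
                 (\<forall>y\<in>V. q y \<noteq> 0 \<and> f y = p y / q y)}) \<rparr>"

definition affine_space :: "nat \<Rightarrow> ('k::field vec, 'k) fspace" where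
  "affine_space N = zariski_space (carrier_vec N) {\<lambda>v. v $ i | i. i < N}"

text \<open>
  The (reduced) structure induced on a subset \<open>A\<close>: functions that locally extend to regular
  functions on the ambient space. For locally closed \<open>A\<close> this is the subvariety structure.
\<close>

definition induced_fspace :: "('p, 'k) fspace \<Rightarrow> 'p set \<Rightarrow> ('p, 'k) fspace" where
  "induced_fspace S A =
     \<lparr> topo = subtopology (topo S) A,
       reg = (\<lambda>U. {f. \<forall>x\<in>U. \<exists>V g.
                 openin (topo S) V \<and> x \<in> V \<and> g \<in> reg S V \<and> (\<forall>y\<in>U \<inter> V. f y = g y)}) \<rparr>"

text \<open>
  The quotient along a map \<open>\<pi>\<close>: quotient topology, and a function is regular iff its
  pullback is. If \<open>\<pi>\<close> maps a point to its orbit, the pullbacks are the invariant functions,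
  so these are the topology and the functions that a geometric quotient must carry.
\<close>

definition quotient_topology :: "'p topology \<Rightarrow> ('p \<Rightarrow> 'q) \<Rightarrow> 'q topology" where
  "quotient_topology T \<pi> =
     topology (\<lambda>U. U \<subseteq> \<pi> ` topspace T \<and> openin T {x \<in> topspace T. \<pi> x \<in> U})"

lemma istopology_quotient:
  "istopology (\<lambda>U. U \<subseteq> \<pi> ` topspace T \<and> openin T {x \<in> topspace T. \<pi> x \<in> U})"
proof (unfold istopology_def, intro conjI allI impI; (elim conjE)?)
  fix U V
  assume "openin T {x \<in> topspace T. \<pi> x \<in> U}" "openin T {x \<in> topspace T. \<pi> x \<in> V}"
  then have "openin T ({x \<in> topspace T. \<pi> x \<in> U} \<inter> {x \<in> topspace T. \<pi> x \<in> V})"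
    by (rule openin_Int)
  also have "{x \<in> topspace T. \<pi> x \<in> U} \<inter> {x \<in> topspace T. \<pi> x \<in> V} =
      {x \<in> topspace T. \<pi> x \<in> U \<inter> V}"
    by blast
  finally show "openin T {x \<in> topspace T. \<pi> x \<in> U \<inter> V}" .
next
  fix K
  assume K: "\<forall>U\<in>K. U \<subseteq> \<pi> ` topspace T \<and> openin T {x \<in> topspace T. \<pi> x \<in> U}"
  then have "openin T (\<Union>U\<in>K. {x \<in> topspace T. \<pi> x \<in> U})"
    by (intro openin_Union) auto
  also have "(\<Union>U\<in>K. {x \<in> topspace T. \<pi> x \<in> U}) = {x \<in> topspace T. \<pi> x \<in> \<Union>K}"
    by blast
  finally show "openin T {x \<in> topspace T. \<pi> x \<in> \<Union>K}" .
qed auto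

lemma openin_quotient_topology:
  "openin (quotient_topology T \<pi>) U \<longleftrightarrow>
     U \<subseteq> \<pi> ` topspace T \<and> openin T {x \<in> topspace T. \<pi> x \<in> U}"
  unfolding quotient_topology_def by (simp add: istopology_quotient)

lemma topspace_quotient_topology: "topspace (quotient_topology T \<pi>) = \<pi> ` topspace T"
proof (rule subset_antisym)
  show "topspace (quotient_topology T \<pi>) \<subseteq> \<pi> ` topspace T"
    using openin_topspace[of "quotient_topology T \<pi>"]
    unfolding openin_quotient_topology by simp
  have "{x \<in> topspace T. \<pi> x \<in> \<pi> ` topspace T} = topspace T"
    by auto
  then have "openin (quotient_topology T \<pi>) (\<pi> ` topspace T)"
    unfolding openin_quotient_topology by simp
  then show "\<pi> ` topspace T \<subseteq> topspace (quotient_topology T \<pi>)"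
    by (rule openin_subset)
qed

definition quotient_fspace :: "('p, 'k) fspace \<Rightarrow> ('p \<Rightarrow> 'q) \<Rightarrow> ('q, 'k) fspace" where
  "quotient_fspace S \<pi> =
     \<lparr> topo = quotient_topology (topo S) \<pi>,
       reg = (\<lambda>U. {f. f \<circ> \<pi> \<in> reg S {x \<in> topspace (topo S). \<pi> x \<in> U}}) \<rparr>"

text \<open>
  Closed subvarieties (not assumed irreducible) are closed subsets. As the differences
  \<open>A i - A (i + 1)\<close> are isomorphic to affine spaces, they are nonempty and pairwise disjoint.
\<close>

definition cell_decomposition ::
    "('p, 'k::field) fspace \<Rightarrow> nat \<Rightarrow> (nat \<Rightarrow> 'p set) \<Rightarrow> bool" where
  "cell_decomposition Y u A \<longleftrightarrow>
     A 1 = topspace (topo Y) \<and> A (u + 1) = {} \<and>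
     (\<forall>i\<in>{1..u+1}. closedin (topo Y) (A i)) \<and>
     (\<forall>i\<in>{1..u}. A (i + 1) \<subseteq> A i \<and>
        (\<exists>N. isomorphic_fspaces (induced_fspace Y (A i - A (i + 1)))
               (affine_space N :: ('k vec, 'k) fspace)))"

definition cells :: "nat \<Rightarrow> (nat \<Rightarrow> 'p set) \<Rightarrow> 'p set set" where
  "cells u A = {A i - A (i + 1) | i. i \<in> {1..u}}"

text \<open>
  \<open>V = K\<^sup>n\<close>, \<open>W = K\<^sup>d\<close>, so that \<open>Hom(V,W)\<close> consists of \<open>d \<times> n\<close> matrices and
  \<open>End(W)\<^sup>m\<close> of lists of \<open>m\<close> square matrices.
\<close>

type_synonym 'k tup = "'k mat \<times> 'k mat list"

definition rep_points :: "nat \<Rightarrow> nat \<Rightarrow> nat \<Rightarrow> 'k tup set" where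
  "rep_points d n m =
     {(f, \<phi>s). f \<in> carrier_mat d n \<and> length \<phi>s = m \<and> set \<phi>s \<subseteq> carrier_mat d d}"

definition rep_coords :: "nat \<Rightarrow> nat \<Rightarrow> nat \<Rightarrow> ('k tup \<Rightarrow> 'k) set" where
  "rep_coords d n m =
     {\<lambda>(f, \<phi>s). f $$ (i, j) | i j. i < d \<and> j < n} \<union>
     {\<lambda>(f, \<phi>s). (\<phi>s ! k) $$ (i, j) | k i j. k < m \<and> i < d \<and> j < d}"

definition rep_space :: "nat \<Rightarrow> nat \<Rightarrow> nat \<Rightarrow> ('k::field tup, 'k) fspace" where
  "rep_space d n m = zariski_space (rep_points d n m) (rep_coords d n m)"

definition GL :: "nat \<Rightarrow> 'k::field mat monoid" where
  "GL d = units_of (ring_mat TYPE('k) d ())"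

definition GL_act :: "nat \<Rightarrow> 'k::field mat \<Rightarrow> 'k tup \<Rightarrow> 'k tup" where
  "GL_act d g = (\<lambda>(f, \<phi>s). (g * f, map (\<lambda>\<phi>. g * \<phi> * inv\<^bsub>GL d\<^esub> g) \<phi>s))"

definition generated_subspace :: "nat \<Rightarrow> nat \<Rightarrow> 'k::field tup \<Rightarrow> 'k vec set" where
  "generated_subspace d n = (\<lambda>(f, \<phi>s).
     \<Inter>{U. VectorSpace.subspace class_ring U (module_vec TYPE('k) d) \<and>
          (\<forall>v\<in>carrier_vec n. f *\<^sub>v v \<in> U) \<and>
          (\<forall>\<phi>\<in>set \<phi>s. \<forall>w\<in>U. \<phi> *\<^sub>v w \<in> U)})"

definition stable_points :: "nat \<Rightarrow> nat \<Rightarrow> nat \<Rightarrow> 'k::field tup set" where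
  "stable_points d n m =
     {x \<in> rep_points d n m. generated_subspace d n x = carrier_vec d}"

text \<open>The points of \<open>X\<^sup>s / GL(W)\<close> are the \<open>GL(W)\<close>-orbits of stable tuples.\<close>

definition nc_hilbert :: "nat \<Rightarrow> nat \<Rightarrow> nat \<Rightarrow> ('k::field tup set, 'k) fspace" where
  "nc_hilbert d n m =
     quotient_fspace (induced_fspace (rep_space d n m) (stable_points d n m))
       (orbit (GL d) (GL_act d))"

lemma topspace_nc_hilbert:
  "topspace (topo (nc_hilbert d n m :: ('k::field tup set, 'k) fspace)) =
     orbits (GL d) (stable_points d n m) (GL_act d)"
proof -
  have "rep_points d n m \<inter> stable_points d n m = (stable_points d n m :: 'k tup set)"
    unfolding stable_points_def by blast
  then show ?thesis
    unfolding orbits_def Setcompr_eq_image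
    by (simp add: nc_hilbert_def quotient_fspace_def induced_fspace_def rep_space_def
        zariski_space_def topspace_quotient_topology topspace_zariski_topology)
qed

definition tree :: "nat \<Rightarrow> nat list set \<Rightarrow> bool" where
  "tree m S \<longleftrightarrow> finite S \<and> S \<subseteq> lists {1..m} \<and> (\<forall>w w'. w @ w' \<in> S \<longrightarrow> w \<in> S)"

definition forests :: "nat \<Rightarrow> nat \<Rightarrow> nat \<Rightarrow> nat list set list set" where
  "forests d n m =
     {Ss. length Ss = n \<and> (\<forall>S\<in>set Ss. tree m S) \<and> sum_list (map card Ss) = d}"

end

theory Submission
  imports Defs "Jordan_Normal_Form.DL_Rank"
begin

text \<open>
  Attach to a tuple \<open>(f, \<phi>)\<close> the vectors \<open>\<phi>\<^sub>w f(e\<^sub>i)\<close>, listed in a well-order for which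
  appending a letter is monotone. Selecting greedily those outside the span of their
  predecessors gives, for a stable tuple, a basis of \<open>W\<close> indexed by a forest \<open>S\<close>. Using this
  basis as coordinates, the orbit acquires a normal form whose only free parameters are the
  coefficients of each vector just outside \<open>S\<close> at the earlier vectors of \<open>S\<close>; every choice of
  parameters occurs, so the orbits with greedy forest \<open>S\<close> form an affine space. Finally, the
  greedy forest is lexicographically first among all forests that index a basis, and indexing a
  basis is the open condition that a determinant does not vanish; removing the cells in
  lexicographic order therefore leaves closed sets.
\<close>

section \<open>Polynomial functions and quotients of Zariski spaces\<close>

text \<open>The quotient is not embedded anywhere: its open sets and functions are known only
  through their pullbacks to stable tuples. Each cell is therefore compared with affine space by two
  maps of different nature. The coefficients of the normal form are rational functions of the tuple,
  defined on the whole open set where the determinant of the forest is nonzero; living beyond the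
  cell, they supply the local extensions that the induced structure asks for. The normal form is a
  polynomial map from parameters back to tuples, so the other direction needs no denominators. The
  order of the vectors must be preserved by appending a letter, so that a dependence of a vector on
  its predecessors passes to its children, and must leave each vector only finitely many
  predecessors, so that natural numbers can replace words. A breadth-first numbering does both. The
  delicate point is that every choice of parameters occurs: the vectors beyond the forest and its
  children are forced, and they must be shown to create no new greedy index.\<close>

definition poly_on :: "'p set \<Rightarrow> ('p \<Rightarrow> 'k::comm_ring_1) set \<Rightarrow> ('p \<Rightarrow> 'k) \<Rightarrow> bool" where
  "poly_on X C r \<longleftrightarrow> (\<exists>p\<in>poly_funs C. \<forall>x\<in>X. p x = r x)"

lemma poly_funs_power: "f \<in> poly_funs C \<Longrightarrow> (\<lambda>x. f x ^ k) \<in> poly_funs C"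
  by (induction k) (auto intro: poly_funs.intros)

lemma poly_onI: "p \<in> poly_funs C \<Longrightarrow> (\<And>x. x \<in> X \<Longrightarrow> p x = r x) \<Longrightarrow> poly_on X C r"
  unfolding poly_on_def by blast

lemma poly_on_cong: "poly_on X C r \<Longrightarrow> (\<And>x. x \<in> X \<Longrightarrow> r x = s x) \<Longrightarrow> poly_on X C s"
  unfolding poly_on_def by auto

lemma poly_on_const: "poly_on X C (\<lambda>_. c)"
  by (rule poly_onI[OF poly_funs.const]) simp

lemma poly_on_coord: "f \<in> C \<Longrightarrow> poly_on X C f"
  by (rule poly_onI[OF poly_funs.coord]) auto

lemma poly_on_add:
  assumes "poly_on X C f" "poly_on X C g"
  shows "poly_on X C (\<lambda>x. f x + g x)"
proof -
  obtain p q where "p \<in> poly_funs C" "\<forall>x\<in>X. p x = f x" "q \<in> poly_funs C" "\<forall>x\<in>X. q x = g x"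
    using assms unfolding poly_on_def by blast
  then show ?thesis
    by (intro poly_onI[OF poly_funs.add[of p _ q]]) auto
qed

lemma poly_on_mult:
  assumes "poly_on X C f" "poly_on X C g"
  shows "poly_on X C (\<lambda>x. f x * g x)"
proof -
  obtain p q where "p \<in> poly_funs C" "\<forall>x\<in>X. p x = f x" "q \<in> poly_funs C" "\<forall>x\<in>X. q x = g x"
    using assms unfolding poly_on_def by blast
  then show ?thesis
    by (intro poly_onI[OF poly_funs.mult[of p _ q]]) auto
qed

lemma poly_on_sum:
  assumes "\<And>i. i \<in> I \<Longrightarrow> poly_on X C (f i)"
  shows "poly_on X C (\<lambda>x. \<Sum>i\<in>I. f i x)"
  using assms
  by (induction I rule: infinite_finite_induct) (auto intro: poly_on_const poly_on_add)

lemma poly_on_prod: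
  assumes "\<And>i. i \<in> I \<Longrightarrow> poly_on X C (f i)"
  shows "poly_on X C (\<lambda>x. \<Prod>i\<in>I. f i x)"
  using assms
  by (induction I rule: infinite_finite_induct) (auto intro: poly_on_const poly_on_mult)

lemma poly_on_compose:
  assumes "p \<in> poly_funs C" and "\<And>c. c \<in> C \<Longrightarrow> poly_on Y D (\<lambda>y. c (\<psi> y))"
  shows "poly_on Y D (\<lambda>y. p (\<psi> y))"
  using assms(1)
  by induction (auto intro: poly_on_const poly_on_add poly_on_mult assms(2))

text \<open>The Leibniz expansion is valid only for matrices of the right size. This is why
  \<open>poly_on\<close> asks for agreement on \<open>X\<close> alone and not as total
  functions.\<close>

lemma poly_on_det:
  assumes "\<And>x. x \<in> X \<Longrightarrow> M x \<in> carrier_mat n n"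
    and "\<And>i j. i < n \<Longrightarrow> j < n \<Longrightarrow> poly_on X C (\<lambda>x. M x $$ (i, j))"
  shows "poly_on X C (\<lambda>x. det (M x))"
proof (rule poly_on_cong)
  show "poly_on X C (\<lambda>x. \<Sum>p\<in>{p. p permutes {0..<n}}. signof p * (\<Prod>i = 0..<n. M x $$ (i, p i)))"
    by (intro poly_on_sum poly_on_mult poly_on_prod poly_on_const assms(2))
      (auto dest: permutes_in_image)
qed (simp add: det_def'[OF assms(1)])

lemma poly_on_cofactor:
  assumes M: "\<And>x. x \<in> X \<Longrightarrow> M x \<in> carrier_mat n n"
    and p: "\<And>i j. i < n \<Longrightarrow> j < n \<Longrightarrow> poly_on X C (\<lambda>x. M x $$ (i, j))"
    and ij: "i < n" "j < n"
  shows "poly_on X C (\<lambda>x. cofactor (M x) i j)"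
  unfolding cofactor_def
proof (intro poly_on_mult poly_on_const poly_on_det)
  show "mat_delete (M x) i j \<in> carrier_mat (n - 1) (n - 1)" if "x \<in> X" for x
    using mat_delete_carrier[OF M[OF that]] .
  fix k l assume kl: "k < n - 1" "l < n - 1"
  show "poly_on X C (\<lambda>x. mat_delete (M x) i j $$ (k, l))"
  proof (rule poly_on_cong)
    show "poly_on X C (\<lambda>x. M x $$ (insert_index i k, insert_index j l))"
      using kl by (intro p) (auto simp: insert_index_def)
    fix x assume "x \<in> X"
    then show "M x $$ (insert_index i k, insert_index j l) = mat_delete (M x) i j $$ (k, l)"
      using mat_delete_index[of "M x" "n - 1" i j k l] M[of x] ij kl by simp
  qed
qed

lemma openin_zariski_subset: "openin (zariski_topology X C) W \<Longrightarrow> W \<subseteq> X"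
  using openin_subset topspace_zariski_topology by metis

lemma openin_zariski_basicI:
  "P \<subseteq> poly_funs C \<Longrightarrow> openin (zariski_topology X C) {x \<in> X. \<exists>p\<in>P. p x \<noteq> 0}"
  unfolding openin_zariski_topology by (intro exI[of _ P] conjI refl)

lemma openin_zariski_nonzero:
  assumes "openin (zariski_topology X C) W" "q \<in> poly_funs C"
  shows "openin (zariski_topology X C) {x \<in> W. q x \<noteq> 0}"
proof -
  have "openin (zariski_topology X C) {x \<in> X. q x \<noteq> 0}"
    unfolding openin_zariski_topology using assms(2) by (intro exI[of _ "{q}"]) auto
  moreover have "{x \<in> W. q x \<noteq> 0} = W \<inter> {x \<in> X. q x \<noteq> 0}"
    using openin_zariski_subset[OF assms(1)] by blast
  ultimately show ?thesis
    using openin_Int[OF assms(1)] by simp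
qed

text \<open>Collapses the quotient, subspace and Zariski topologies into one criterion: exhibit
  polynomials on the ambient space. These need not be invariant, only their common zero locus on
  \<open>Xs\<close> has to be a union of fibres.\<close>

lemma openin_quotient_induced_zariski:
  assumes "Xs \<subseteq> X"
  shows "openin (topo (quotient_fspace (induced_fspace (zariski_space X C) Xs) \<pi>)) U \<longleftrightarrow>
    U \<subseteq> \<pi> ` Xs \<and> (\<exists>P\<subseteq>poly_funs C. \<forall>x\<in>Xs. \<pi> x \<in> U \<longleftrightarrow> (\<exists>p\<in>P. p x \<noteq> 0))" (is "_ = ?R")
proof -
  have XX: "X \<inter> Xs = Xs"
    using assms by blast
  have "(\<exists>T. openin (zariski_topology X C) T \<and> {x \<in> Xs. \<pi> x \<in> U} = T \<inter> Xs) \<longleftrightarrow>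
    (\<exists>P\<subseteq>poly_funs C. \<forall>x\<in>Xs. \<pi> x \<in> U \<longleftrightarrow> (\<exists>p\<in>P. p x \<noteq> 0))" (is "?A = ?B")
  proof
    assume ?A
    then obtain P where P: "P \<subseteq> poly_funs C" 
      and *: "{x \<in> Xs. \<pi> x \<in> U} = {x \<in> X. \<exists>p\<in>P. p x \<noteq> 0} \<inter> Xs"
      unfolding openin_zariski_topology by blast
    have "\<forall>x\<in>Xs. \<pi> x \<in> U \<longleftrightarrow> (\<exists>p\<in>P. p x \<noteq> 0)"
      using * assms by blast
    with P show ?B by blast
  next
    assume ?B
    then obtain P where P: "P \<subseteq> poly_funs C" 
      and *: "\<forall>x\<in>Xs. \<pi> x \<in> U \<longleftrightarrow> (\<exists>p\<in>P. p x \<noteq> 0)"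
      by blast
    have "{x \<in> Xs. \<pi> x \<in> U} = {x \<in> X. \<exists>p\<in>P. p x \<noteq> 0} \<inter> Xs"
      using * assms by blast
    with P show ?A
      unfolding openin_zariski_topology by blast
  qed
  then show ?thesis
    by (simp add: quotient_fspace_def induced_fspace_def zariski_space_def
        openin_quotient_topology openin_subtopology topspace_zariski_topology XX)
qed

text \<open>An induced regular function extends locally to one that is again locally a fraction;
  shrinking the neighbourhood once more merges the two existential layers into a single fraction on
  \<open>Xs\<close>.\<close>

lemma reg_quotient_induced_zariski:
  assumes "Xs \<subseteq> X"
  shows "g \<in> reg (quotient_fspace (induced_fspace (zariski_space X C) Xs) \<pi>) U \<longleftrightarrow>
    (\<forall>x\<in>Xs. \<pi> x \<in> U \<longrightarrow> (\<exists>W p q. openin (zariski_topology X C) W \<and> x \<in> W \<and>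
      p \<in> poly_funs C \<and> q \<in> poly_funs C \<and>
      (\<forall>y\<in>Xs \<inter> W. \<pi> y \<in> U \<longrightarrow> q y \<noteq> 0 \<and> g (\<pi> y) = p y / q y)))" (is "?L = ?R")
proof -
  have XX: "X \<inter> Xs = Xs"
    using assms by blast
  let ?Z = "zariski_topology X C"
  let ?loc = "\<lambda>V h x W p q. openin ?Z W \<and> x \<in> W \<and> W \<subseteq> V \<and> p \<in> poly_funs C \<and>
    q \<in> poly_funs C \<and> (\<forall>y\<in>W. q y \<noteq> 0 \<and> h y = p y / q y)"
  have unf: "?L \<longleftrightarrow> (\<forall>x. x \<in> Xs \<and> \<pi> x \<in> U \<longrightarrow> (\<exists>V. openin ?Z V \<and> x \<in> V \<and>
    (\<exists>h. (\<forall>x\<in>V. \<exists>W p q. ?loc V h x W p q) \<and>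
      (\<forall>y\<in>{x \<in> Xs. \<pi> x \<in> U} \<inter> V. g (\<pi> y) = h y))))"
    by (simp add: quotient_fspace_def induced_fspace_def zariski_space_def
        topspace_zariski_topology XX del: Int_iff)
  show ?thesis
  proof
    assume L: ?L
    show ?R
    proof (intro ballI impI)
      fix x assume x: "x \<in> Xs" "\<pi> x \<in> U"
      then obtain V h where V: "x \<in> V" and h: "\<forall>x\<in>V. \<exists>W p q. ?loc V h x W p q"
        and eq: "\<forall>y\<in>{x \<in> Xs. \<pi> x \<in> U} \<inter> V. g (\<pi> y) = h y"
        using L[unfolded unf, rule_format, of x] by blast
      obtain W p q where "?loc V h x W p q"
        using bspec[OF h V] by (elim exE)
      then show "\<exists>W p q. openin ?Z W \<and> x \<in> W \<and> p \<in> poly_funs C \<and> q \<in> poly_funs C \<and>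
        (\<forall>y\<in>Xs \<inter> W. \<pi> y \<in> U \<longrightarrow> q y \<noteq> 0 \<and> g (\<pi> y) = p y / q y)"
        using eq by (intro exI[of _ W] exI[of _ p] exI[of _ q]) auto
    qed
  next
    assume R: ?R
    show ?L
      unfolding unf
    proof (intro allI impI, elim conjE)
      fix x assume x: "x \<in> Xs" "\<pi> x \<in> U"
      obtain W p q where W: "openin ?Z W" "x \<in> W" "p \<in> poly_funs C" "q \<in> poly_funs C"
        and eq: "\<forall>y\<in>Xs \<inter> W. \<pi> y \<in> U \<longrightarrow> q y \<noteq> 0 \<and> g (\<pi> y) = p y / q y"
        using bspec[OF R x(1)] x(2) by blast
      \<comment> \<open>The denominator is known to be nonzero only on \<open>Xs\<close>; the
        extension to the ambient space needs an open set on which it vanishes nowhere.\<close>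
      let ?V = "{y \<in> W. q y \<noteq> 0}"
      have V: "openin ?Z ?V" "x \<in> ?V"
        using W x eq by (auto intro: openin_zariski_nonzero)
      moreover have "\<forall>x\<in>?V. \<exists>W p' q'. ?loc ?V (\<lambda>y. p y / q y) x W p' q'"
        using V W by (intro ballI exI[of _ ?V] exI[of _ p] exI[of _ q]) auto
      moreover have "\<forall>y\<in>{x \<in> Xs. \<pi> x \<in> U} \<inter> ?V. g (\<pi> y) = p y / q y"
        using eq by auto
      ultimately show "\<exists>V. openin ?Z V \<and> x \<in> V \<and>
        (\<exists>h. (\<forall>x\<in>V. \<exists>W p q. ?loc V h x W p q) \<and>
          (\<forall>y\<in>{x \<in> Xs. \<pi> x \<in> U} \<inter> V. g (\<pi> y) = h y))"
        by (intro exI[of _ ?V] conjI exI[of _ "\<lambda>y. p y / q y"])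
    qed
  qed
qed

section \<open>A criterion for affine cells of a quotient\<close>

abbreviation vec_coords :: "nat \<Rightarrow> ('k vec \<Rightarrow> 'k) set" where
  "vec_coords N \<equiv> {\<lambda>v. v $ i | i. i < N}"

text \<open>
  The criterion for \<open>A\<close> to be an affine cell of the quotient of \<open>Xs\<close> by \<open>\<pi>\<close>: invariant
  coordinates \<open>crd\<close> that are rational with denominator \<open>D\<close>, and a polynomial section \<open>\<psi>\<close>
  over \<open>A\<close>.
\<close>

locale quotient_chart =
  fixes X Xs :: "'p set" and C :: "('p \<Rightarrow> 'k::field) set" and \<pi> :: "'p \<Rightarrow> 'q"
    and A :: "'q set" and D :: "'p \<Rightarrow> 'k" and N :: nat
    and crd :: "'p \<Rightarrow> 'k vec" and \<psi> :: "'k vec \<Rightarrow> 'p"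
  assumes Xs: "Xs \<subseteq> X" and A: "A \<subseteq> \<pi> ` Xs"
    and D_poly: "poly_on X C D"
    and crd: "\<And>x. x \<in> Xs \<Longrightarrow> crd x \<in> carrier_vec N"
    and crd_poly: "\<And>j. j < N \<Longrightarrow> poly_on {x \<in> X. D x \<noteq> 0} C (\<lambda>x. D x * crd x $ j)"
    and invariant: "\<And>x y. x \<in> Xs \<Longrightarrow> y \<in> Xs \<Longrightarrow> \<pi> x = \<pi> y \<Longrightarrow> D x \<noteq> 0 \<Longrightarrow> D y \<noteq> 0 \<and> crd y = crd x"
    and section_poly: "\<And>c. c \<in> C \<Longrightarrow> poly_on (carrier_vec N) (vec_coords N) (\<lambda>v. c (\<psi> v))"
    and section_points: "\<And>v. v \<in> carrier_vec N \<Longrightarrow> \<psi> v \<in> Xs \<and> D (\<psi> v) \<noteq> 0 \<and> crd (\<psi> v) = v \<and> \<pi> (\<psi> v) \<in> A"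
    and cell_points: "\<And>x. x \<in> Xs \<Longrightarrow> \<pi> x \<in> A \<Longrightarrow> D x \<noteq> 0 \<and> \<pi> (\<psi> (crd x)) = \<pi> x"
begin

text \<open>By \<open>invariant\<close> the choice of representative does not matter where
  \<open>D\<close> is nonzero, and only there is the value used.\<close>

definition chart :: "'q \<Rightarrow> 'k vec" where
  "chart q = crd (SOME x. x \<in> Xs \<and> \<pi> x = q)"

lemma chart_proj: "x \<in> Xs \<Longrightarrow> D x \<noteq> 0 \<Longrightarrow> chart (\<pi> x) = crd x"
  unfolding chart_def
  using someI[of "\<lambda>y. y \<in> Xs \<and> \<pi> y = \<pi> x" x] invariant[of x] by (metis (mono_tags, lifting))

text \<open>Every coordinate is a fraction with denominator \<open>D\<close>, so a polynomial in the
  coordinates has a power of \<open>D\<close> as denominator; sums and products of fractions are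
  formed over the product of the two powers.\<close>

lemma clear_denominators:
  assumes "p \<in> poly_funs (vec_coords N)"
  shows "\<exists>P\<in>poly_funs C. \<exists>k. \<forall>x\<in>X. D x \<noteq> 0 \<longrightarrow> D x ^ k * p (crd x) = P x"
  using assms
proof induction
  case (const c)
  show ?case
    by (rule bexI[OF _ poly_funs.const[of c]], rule exI[of _ 0]) auto
next
  case (coord f)
  then obtain j where "j < N" and f: "f = (\<lambda>v. v $ j)"
    by blast
  then obtain P where "P \<in> poly_funs C" "\<forall>x\<in>X. D x \<noteq> 0 \<longrightarrow> P x = D x * crd x $ j"
    using crd_poly[of j] unfolding poly_on_def by blast
  then show ?case
    unfolding f by (intro bexI[of _ P] exI[of _ 1]) auto
next
  case (add f g)
  obtain E where E: "E \<in> poly_funs C" "\<forall>x\<in>X. E x = D x"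
    using D_poly unfolding poly_on_def by blast
  from add.IH obtain P k Q l where P: "P \<in> poly_funs C" "\<forall>x\<in>X. D x \<noteq> 0 \<longrightarrow> D x ^ k * f (crd x) = P x"
    and Q: "Q \<in> poly_funs C" "\<forall>x\<in>X. D x \<noteq> 0 \<longrightarrow> D x ^ l * g (crd x) = Q x"
    by blast
  have "(\<lambda>x. E x ^ l * P x + E x ^ k * Q x) \<in> poly_funs C"
    by (intro poly_funs.add poly_funs.mult poly_funs_power E(1) P Q)
  moreover have "D x ^ (k + l) * (f (crd x) + g (crd x)) = E x ^ l * P x + E x ^ k * Q x"
    if "x \<in> X" "D x \<noteq> 0" for x
  proof -
    have "P x = D x ^ k * f (crd x)" "Q x = D x ^ l * g (crd x)" "E x = D x"
      using P Q E that by auto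
    then show ?thesis
      by (simp add: algebra_simps power_add)
  qed
  ultimately show ?case
    by (intro bexI[of _ "\<lambda>x. E x ^ l * P x + E x ^ k * Q x"] exI[of _ "k + l"]) simp_all
next
  case (mult f g)
  from mult.IH obtain P k Q l where P: "P \<in> poly_funs C" "\<forall>x\<in>X. D x \<noteq> 0 \<longrightarrow> D x ^ k * f (crd x) = P x"
    and Q: "Q \<in> poly_funs C" "\<forall>x\<in>X. D x \<noteq> 0 \<longrightarrow> D x ^ l * g (crd x) = Q x"
    by blast
  have "(\<lambda>x. P x * Q x) \<in> poly_funs C"
    by (intro poly_funs.mult P Q)
  moreover have "D x ^ (k + l) * (f (crd x) * g (crd x)) = P x * Q x"
    if "x \<in> X" "D x \<noteq> 0" for x
  proof -
    have "P x = D x ^ k * f (crd x)" "Q x = D x ^ l * g (crd x)"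
      using P Q that by auto
    then show ?thesis
      by (simp add: algebra_simps power_add)
  qed
  ultimately show ?case
    by (intro bexI[of _ "\<lambda>x. P x * Q x"] exI[of _ "k + l"]) simp_all
qed

text \<open>Multiplying by one more factor \<open>D\<close> makes the cleared function vanish outside the chart domain.\<close>

lemma clear_denominators_nonzero:
  assumes "p \<in> poly_funs (vec_coords N)"
  shows "\<exists>P\<in>poly_funs C. \<forall>x\<in>X. P x \<noteq> 0 \<longleftrightarrow> D x \<noteq> 0 \<and> p (crd x) \<noteq> 0"
proof -
  obtain E where E: "E \<in> poly_funs C" "\<forall>x\<in>X. E x = D x"
    using D_poly unfolding poly_on_def by blast
  obtain P k where P: "P \<in> poly_funs C" "\<forall>x\<in>X. D x \<noteq> 0 \<longrightarrow> D x ^ k * p (crd x) = P x"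
    using clear_denominators[OF assms] by blast
  have "E x * P x \<noteq> 0 \<longleftrightarrow> D x \<noteq> 0 \<and> p (crd x) \<noteq> 0" if "x \<in> X" for x
    using E P that by (cases "D x = 0") (auto simp: P(2)[rule_format, symmetric])
  moreover have "(\<lambda>x. E x * P x) \<in> poly_funs C"
    by (intro poly_funs.mult E P)
  ultimately show ?thesis
    by (intro bexI[of _ "\<lambda>x. E x * P x"]) simp_all
qed

section \<open>The chart as a homeomorphism\<close>

abbreviation Z where "Z \<equiv> zariski_topology X C"
abbreviation aff where "aff \<equiv> zariski_topology (carrier_vec N) (vec_coords N :: ('k vec \<Rightarrow> 'k) set)"
abbreviation Q where "Q \<equiv> quotient_fspace (induced_fspace (zariski_space X C) Xs) \<pi>"

lemma openin_Q: "openin (topo Q) U \<longleftrightarrow>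
    U \<subseteq> \<pi> ` Xs \<and> (\<exists>P\<subseteq>poly_funs C. \<forall>x\<in>Xs. \<pi> x \<in> U \<longleftrightarrow> (\<exists>p\<in>P. p x \<noteq> 0))"
  by (rule openin_quotient_induced_zariski[OF Xs])

text \<open>A subset of the whole quotient, not just of \<open>A\<close>: for open \<open>V\<close>
  it serves as the neighbourhood on which functions on \<open>A\<close> are extended.\<close>

definition chart_dom where "chart_dom V = {\<pi> x | x. x \<in> Xs \<and> D x \<noteq> 0 \<and> crd x \<in> V}"

lemma mem_chart_dom:
  assumes "x \<in> Xs"
  shows "\<pi> x \<in> chart_dom V \<longleftrightarrow> D x \<noteq> 0 \<and> crd x \<in> V"
proof
  assume "\<pi> x \<in> chart_dom V"
  then obtain y where "y \<in> Xs" "D y \<noteq> 0" "crd y \<in> V" "\<pi> y = \<pi> x"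
    unfolding chart_dom_def by auto
  then show "D x \<noteq> 0 \<and> crd x \<in> V"
    using invariant[of y x] assms by metis
qed (use assms in \<open>unfold chart_dom_def, blast\<close>)

lemma open_chart_dom:
  assumes "openin aff V"
  shows "openin (topo Q) (chart_dom V)"
proof -
  obtain P where P: "P \<subseteq> poly_funs (vec_coords N)" "V = {v \<in> carrier_vec N. \<exists>p\<in>P. p v \<noteq> 0}"
    using assms unfolding openin_zariski_topology by blast
  have "\<forall>p\<in>P. \<exists>P'\<in>poly_funs C. \<forall>x\<in>X. P' x \<noteq> 0 \<longleftrightarrow> D x \<noteq> 0 \<and> p (crd x) \<noteq> 0"
    by (intro ballI clear_denominators_nonzero subsetD[OF P(1)])
  from bchoice[OF this[unfolded Bex_def]] obtain F where F: "\<forall>p\<in>P. F p \<in> poly_funs C \<and> (\<forall>x\<in>X. F p x \<noteq> 0 \<longleftrightarrow> D x \<noteq> 0 \<and> p (crd x) \<noteq> 0)"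
    by (elim exE)
  have "\<pi> x \<in> chart_dom V \<longleftrightarrow> (\<exists>p\<in>F ` P. p x \<noteq> 0)" if "x \<in> Xs" for x
  proof -
    have "\<pi> x \<in> chart_dom V \<longleftrightarrow> D x \<noteq> 0 \<and> (\<exists>p\<in>P. p (crd x) \<noteq> 0)"
      unfolding mem_chart_dom[OF that] P(2) using crd[OF that] by simp
    also have "\<dots> \<longleftrightarrow> (\<exists>p\<in>P. F p x \<noteq> 0)"
      using F Xs that by (metis subsetD)
    finally show ?thesis by simp
  qed
  moreover have "F ` P \<subseteq> poly_funs C"
    using F by blast
  moreover have "chart_dom V \<subseteq> \<pi> ` Xs"
    unfolding chart_dom_def by blast
  ultimately show ?thesis
    unfolding openin_Q by (intro conjI exI[of _ "F ` P"] ballI)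
qed

lemma compose_section:
  assumes "p \<in> poly_funs C"
  shows "\<exists>p'\<in>poly_funs (vec_coords N). \<forall>v\<in>carrier_vec N. p' v = p (\<psi> v)"
  using poly_on_compose[OF assms section_poly] unfolding poly_on_def .

lemma open_section_preimage:
  assumes "openin Z W"
  shows "openin aff {v \<in> carrier_vec N. \<psi> v \<in> W}"
proof -
  obtain P where P: "P \<subseteq> poly_funs C" "W = {x \<in> X. \<exists>p\<in>P. p x \<noteq> 0}"
    using assms unfolding openin_zariski_topology by blast
  have "\<forall>p\<in>P. \<exists>P'\<in>poly_funs (vec_coords N). \<forall>v\<in>carrier_vec N. P' v = p (\<psi> v)"
    by (intro ballI compose_section subsetD[OF P(1)])
  from bchoice[OF this[unfolded Bex_def]] obtain F where F: "\<forall>p\<in>P. F p \<in> poly_funs (vec_coords N) \<and> (\<forall>v\<in>carrier_vec N. F p v = p (\<psi> v))"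
    by (elim exE)
  have "{v \<in> carrier_vec N. \<psi> v \<in> W} = {v \<in> carrier_vec N. \<exists>p\<in>F ` P. p v \<noteq> 0}"
  proof -
    have "\<psi> v \<in> W \<longleftrightarrow> (\<exists>p\<in>F ` P. p v \<noteq> 0)" if "v \<in> carrier_vec N" for v
    proof -
      have "\<psi> v \<in> X"
        using section_points[OF that] Xs by blast
      then show ?thesis
        using F that unfolding P(2) by simp
    qed
    then show ?thesis by blast
  qed
  moreover have "F ` P \<subseteq> poly_funs (vec_coords N)"
    using F by blast
  ultimately show ?thesis
    by (simp only: openin_zariski_basicI)
qed

lemma chart_section: "v \<in> carrier_vec N \<Longrightarrow> chart (\<pi> (\<psi> v)) = v"
  using chart_proj section_points by simp

lemma chart_cell:
  assumes "q \<in> A"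
  shows "chart q \<in> carrier_vec N \<and> \<pi> (\<psi> (chart q)) = q"
proof -
  obtain x where "x \<in> Xs" "q = \<pi> x"
    using assms A by blast
  then show ?thesis
    using cell_points assms chart_proj crd by simp
qed

lemma chart_dom_cell: "V \<subseteq> carrier_vec N \<Longrightarrow> {q \<in> A. chart q \<in> V} = A \<inter> chart_dom V"
proof -
  have "chart q \<in> V \<longleftrightarrow> q \<in> chart_dom V" if qA: "q \<in> A" for q
  proof -
    obtain x where "x \<in> Xs" "q = \<pi> x"
      using qA A by blast
    then show ?thesis
      using cell_points qA chart_proj mem_chart_dom by simp
  qed
  then show ?thesis by blast
qed

text \<open>The inverse is the projected section \<open>\<lambda>v. \<pi> (\<psi> v)\<close>.
  Clearing denominators makes the chart continuous; the inverse is continuous because the section is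
  polynomial.\<close>

lemma homeomorphic_chart: "homeomorphic_map (subtopology (topo Q) A) aff chart"
proof -
  have tQ: "topspace (topo Q) = \<pi> ` Xs"
    using Xs by (simp add: quotient_fspace_def induced_fspace_def zariski_space_def Int_absorb1
        topspace_quotient_topology topspace_zariski_topology)
  have t: "topspace (subtopology (topo Q) A) = A"
    using A by (auto simp: tQ)
  have "continuous_map (subtopology (topo Q) A) aff chart"
    unfolding continuous_map_def t topspace_zariski_topology
  proof (intro conjI allI impI)
    fix V assume V: "openin aff V"
    have "{q \<in> A. chart q \<in> V} = chart_dom V \<inter> A"
      using chart_dom_cell[OF openin_zariski_subset[OF V]] by blast
    then show "openin (subtopology (topo Q) A) {q \<in> A. chart q \<in> V}"
      using open_chart_dom[OF V] unfolding openin_subtopology by blast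
  qed (use chart_cell in blast)
  moreover have "continuous_map aff (subtopology (topo Q) A) (\<lambda>v. \<pi> (\<psi> v))"
    unfolding continuous_map_def t topspace_zariski_topology
  proof (intro conjI allI impI)
    fix U assume "openin (subtopology (topo Q) A) U"
    then obtain U' where "openin (topo Q) U'" and U: "U = U' \<inter> A"
      unfolding openin_subtopology by blast
    then obtain P where P: "P \<subseteq> poly_funs C" "\<forall>x\<in>Xs. \<pi> x \<in> U' \<longleftrightarrow> (\<exists>p\<in>P. p x \<noteq> 0)"
      unfolding openin_Q by blast
    have "openin Z {x \<in> X. \<exists>p\<in>P. p x \<noteq> 0}"
      by (rule openin_zariski_basicI[OF P(1)])
    from open_section_preimage[OF this]
    show "openin aff {v \<in> carrier_vec N. \<pi> (\<psi> v) \<in> U}"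
      by (rule back_subst[of "openin aff"]) (use P(2) section_points Xs in \<open>auto simp: U\<close>)
  qed (use section_points in blast)
  ultimately show ?thesis
    unfolding homeomorphic_map_maps homeomorphic_maps_def t topspace_zariski_topology
    using chart_cell chart_section by blast
qed

section \<open>Regular functions under the chart\<close>

lemma reg_affine_space:
  "f \<in> reg (affine_space N) V \<longleftrightarrow> (\<forall>v\<in>V. \<exists>W p q. openin aff W \<and> v \<in> W \<and> W \<subseteq> V \<and>
     p \<in> poly_funs (vec_coords N) \<and> q \<in> poly_funs (vec_coords N) \<and>
     (\<forall>w\<in>W. q w \<noteq> 0 \<and> f w = p w / q w))"
  by (simp add: affine_space_def zariski_space_def)

lemma reg_Q: "g \<in> reg Q U \<longleftrightarrow>
    (\<forall>x\<in>Xs. \<pi> x \<in> U \<longrightarrow> (\<exists>W p q. openin Z W \<and> x \<in> W \<and> p \<in> poly_funs C \<and> q \<in> poly_funs C \<and>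
      (\<forall>y\<in>Xs \<inter> W. \<pi> y \<in> U \<longrightarrow> q y \<noteq> 0 \<and> g (\<pi> y) = p y / q y)))"
  by (rule reg_quotient_induced_zariski[OF Xs])

text \<open>The required extension is \<open>f \<circ> chart\<close> itself: near a point it makes
  sense on an open chart domain in the quotient, where its pullback is a fraction of polynomials
  once denominators are cleared.\<close>

lemma chart_pullback_regular:
  assumes V: "openin aff V" and f: "f \<in> reg (affine_space N) V"
  shows "f \<circ> chart \<in> reg (induced_fspace Q A) {q \<in> A. chart q \<in> V}"
proof -
  have "\<exists>U g. openin (topo Q) U \<and> q0 \<in> U \<and> g \<in> reg Q U \<and>
      (\<forall>y\<in>{q \<in> A. chart q \<in> V} \<inter> U. (f \<circ> chart) y = g y)"
    if q0: "q0 \<in> A" "chart q0 \<in> V" for q0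
  proof -
    obtain W p q where W: "openin aff W" "chart q0 \<in> W" "W \<subseteq> V"
      and pq: "p \<in> poly_funs (vec_coords N)" "q \<in> poly_funs (vec_coords N)"
        "\<forall>w\<in>W. q w \<noteq> 0 \<and> f w = p w / q w"
      using bspec[OF f[unfolded reg_affine_space] q0(2)] by (elim exE conjE) (rule that)
    obtain P k where P: "P \<in> poly_funs C" "\<forall>x\<in>X. D x \<noteq> 0 \<longrightarrow> D x ^ k * p (crd x) = P x"
      using clear_denominators[OF pq(1)] by (elim exE bexE)
    obtain R l where R: "R \<in> poly_funs C" "\<forall>x\<in>X. D x \<noteq> 0 \<longrightarrow> D x ^ l * q (crd x) = R x"
      using clear_denominators[OF pq(2)] by (elim exE bexE)
    obtain E where E: "E \<in> poly_funs C" "\<forall>x\<in>X. E x = D x"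
      using D_poly unfolding poly_on_def by blast
    have "f \<circ> chart \<in> reg Q (chart_dom W)"
      unfolding reg_Q
    proof (intro ballI impI exI conjI)
      show "openin Z X"
        by (metis openin_topspace topspace_zariski_topology)
      show "x \<in> X" if "x \<in> Xs" for x
        using that Xs by blast
      \<comment> \<open>With \<open>p = P / D^k\<close> and \<open>q = R / D^l\<close> at the point
        \<open>crd x\<close>, the fraction \<open>p / q\<close> becomes
        \<open>(D^l * P) / (D^k * R)\<close>.\<close>
      show "(\<lambda>x. E x ^ l * P x) \<in> poly_funs C" "(\<lambda>x. E x ^ k * R x) \<in> poly_funs C"
        by (intro poly_funs.mult poly_funs_power E(1) P R)+
      fix y assume y: "y \<in> Xs \<inter> X" "\<pi> y \<in> chart_dom W"
      then have D: "D y \<noteq> 0" "crd y \<in> W"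
        using mem_chart_dom by auto
      then have *: "P y = D y ^ k * p (crd y)" "R y = D y ^ l * q (crd y)" "E y = D y"
        "q (crd y) \<noteq> 0" "f (crd y) = p (crd y) / q (crd y)" "chart (\<pi> y) = crd y"
        using y P R E pq(3) chart_proj by auto
      show "E y ^ k * R y \<noteq> 0"
        using * D by simp
      show "(f \<circ> chart) (\<pi> y) = (E y ^ l * P y) / (E y ^ k * R y)"
        using * D by simp
    qed
    moreover have "q0 \<in> chart_dom W"
      using chart_dom_cell[OF openin_zariski_subset[OF W(1)]] q0(1) W(2) by blast
    moreover have "\<forall>y\<in>{q \<in> A. chart q \<in> V} \<inter> chart_dom W. (f \<circ> chart) y = (f \<circ> chart) y"
      by simp
    ultimately show ?thesis
      using open_chart_dom[OF W(1)] by (intro exI[of _ "chart_dom W"] exI[of _ "f \<circ> chart"] conjI)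
  qed
  then show ?thesis
    by (simp add: induced_fspace_def)
qed

text \<open>Along the section, \<open>f\<close> is the extended function evaluated at
  \<open>\<pi> (\<psi> v)\<close>; substituting the polynomial map \<open>\<psi>\<close> into its
  local fraction gives a local fraction for \<open>f\<close>.\<close>

lemma chart_regular_descends:
  assumes V: "openin aff V" and f: "f \<circ> chart \<in> reg (induced_fspace Q A) {q \<in> A. chart q \<in> V}"
  shows "f \<in> reg (affine_space N) V"
  unfolding reg_affine_space
proof
  fix v assume v: "v \<in> V"
  then have vN: "v \<in> carrier_vec N"
    using openin_zariski_subset[OF V] by blast
  let ?q = "\<pi> (\<psi> v)"
  have q: "?q \<in> A" "chart ?q \<in> V"
    using vN v section_points chart_section by auto
  have "\<exists>U g. openin (topo Q) U \<and> ?q \<in> U \<and> g \<in> reg Q U \<and>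
      (\<forall>y\<in>{q \<in> A. chart q \<in> V} \<inter> U. (f \<circ> chart) y = g y)"
    using f q by (simp add: induced_fspace_def)
  then obtain U g where U: "openin (topo Q) U" "?q \<in> U" "g \<in> reg Q U"
    and g: "\<forall>y\<in>{q \<in> A. chart q \<in> V} \<inter> U. (f \<circ> chart) y = g y"
    by (elim exE conjE) (rule that)
  have "\<psi> v \<in> Xs"
    using section_points[OF vN] by blast
  from bspec[OF U(3)[unfolded reg_Q] this, THEN mp, OF U(2)] obtain W p q where W: "openin Z W" "\<psi> v \<in> W"
    and pq: "p \<in> poly_funs C" "q \<in> poly_funs C"
      "\<forall>y\<in>Xs \<inter> W. \<pi> y \<in> U \<longrightarrow> q y \<noteq> 0 \<and> g (\<pi> y) = p y / q y"
    by (elim exE conjE) (rule that)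
  from U(1) obtain P where P: "P \<subseteq> poly_funs C" "\<forall>x\<in>Xs. \<pi> x \<in> U \<longleftrightarrow> (\<exists>p\<in>P. p x \<noteq> 0)"
    unfolding openin_Q by blast
  have "openin Z {x \<in> X. \<exists>p\<in>P. p x \<noteq> 0}"
    by (rule openin_zariski_basicI[OF P(1)])
  then have oW: "openin Z (W \<inter> {x \<in> X. \<exists>p\<in>P. p x \<noteq> 0})"
    using W(1) by blast
  \<comment> \<open>The section must land both in \<open>W\<close>, where the fraction is valid, and
    in the polynomial locus that describes the preimage of \<open>U\<close>.\<close>
  let ?V = "V \<inter> {v \<in> carrier_vec N. \<psi> v \<in> W \<inter> {x \<in> X. \<exists>p\<in>P. p x \<noteq> 0}}"
  have oV: "openin aff ?V"
    using V open_section_preimage[OF oW] by blast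
  have vV: "v \<in> ?V"
    using v vN W P(2) U(2) section_points[OF vN] Xs by auto
  obtain p' where p': "p' \<in> poly_funs (vec_coords N)" "\<forall>v\<in>carrier_vec N. p' v = p (\<psi> v)"
    using compose_section[OF pq(1)] by (elim bexE)
  obtain q' where q': "q' \<in> poly_funs (vec_coords N)" "\<forall>v\<in>carrier_vec N. q' v = q (\<psi> v)"
    using compose_section[OF pq(2)] by (elim bexE)
  have "q' w \<noteq> 0 \<and> f w = p' w / q' w" if w: "w \<in> ?V" for w
  proof -
    have s: "\<psi> w \<in> Xs" "\<pi> (\<psi> w) \<in> A" "chart (\<pi> (\<psi> w)) = w"
      using w section_points chart_section by auto
    moreover have wU: "\<pi> (\<psi> w) \<in> U"
      using P(2) s w by auto
    ultimately have "f w = g (\<pi> (\<psi> w))"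
      using g[rule_format, of "\<pi> (\<psi> w)"] w by simp
    moreover have "q (\<psi> w) \<noteq> 0 \<and> g (\<pi> (\<psi> w)) = p (\<psi> w) / q (\<psi> w)"
      using pq(3) s w wU by blast
    ultimately show ?thesis
      using p' q' w by simp
  qed
  then have "\<forall>w\<in>?V. q' w \<noteq> 0 \<and> f w = p' w / q' w"
    by blast
  then show "\<exists>W p q. openin aff W \<and> v \<in> W \<and> W \<subseteq> V \<and>
     p \<in> poly_funs (vec_coords N) \<and> q \<in> poly_funs (vec_coords N) \<and>
     (\<forall>w\<in>W. q w \<noteq> 0 \<and> f w = p w / q w)"
    using oV vV p'(1) q'(1) by (intro exI[of _ ?V] exI[of _ p'] exI[of _ q'] conjI Int_lower1)
qed

theorem cell_isomorphic_affine_space: "isomorphic_fspaces (induced_fspace Q A) (affine_space N)"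
proof -
  have topo: "topo (induced_fspace Q A) = subtopology (topo Q) A" "topo (affine_space N) = aff"
    by (simp_all add: induced_fspace_def affine_space_def zariski_space_def)
  have t: "topspace (subtopology (topo Q) A) = A"
    using A Xs by (simp add: quotient_fspace_def induced_fspace_def zariski_space_def Int_absorb1
        topspace_quotient_topology topspace_zariski_topology)
  have "fspace_iso (induced_fspace Q A) (affine_space N) chart"
    unfolding fspace_iso_def topo t
    using homeomorphic_chart chart_pullback_regular chart_regular_descends by blast
  then show ?thesis
    unfolding isomorphic_fspaces_def by blast
qed

end

section \<open>Forests as finite sets of numbers\<close>

lemma parent_less: "0 < n \<Longrightarrow> n \<le> a \<Longrightarrow> (a - n) div m < (a::nat)"
  by (metis diff_less div_le_dividend dual_order.strict_trans1 dual_order.strict_trans2)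

lemma parent_child:
  "j < m \<Longrightarrow> (n + m * p + j - n) div m = p \<and> (n + m * p + j - n) mod m = (j::nat)"
  by simp

lemma node_cases:
  fixes a :: nat
  assumes "0 < n" "0 < m"
  obtains "a < n" | p j where "j < m" "a = n + m * p + j" "p < a"
proof (cases "a < n")
  case False
  then have "a = n + m * ((a - n) div m) + (a - n) mod m"
    by simp
  then show ?thesis
    using that(2)[of "(a - n) mod m" "(a - n) div m"] parent_less[of n a m] assms False by simp
qed (use that in blast)

text \<open>Every number is a root or a child of a smaller number, so this is structural induction
  over all words below all roots.\<close>

lemma node_induct:
  fixes a :: nat
  assumes nm: "0 < n" "0 < m" and root: "\<And>a. a < n \<Longrightarrow> P a"
    and child: "\<And>p j. j < m \<Longrightarrow> P p \<Longrightarrow> P (n + m * p + j)"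
  shows "P a"
proof (induction a rule: less_induct)
  case (less a)
  show ?case
    by (rule node_cases[OF nm, of a]) (use less root child in auto)
qed

text \<open>
  The word \<open>w\<close> below the root \<open>i\<close> is encoded by a number: the roots are \<open>0, \<dots>, n - 1\<close>, and the
  \<open>j\<close>-th child of \<open>p\<close> is \<open>n + m * p + j\<close>. This breadth-first numbering is a bijection for
  which appending a fixed letter is strictly increasing.
\<close>

definition word_code :: "nat \<Rightarrow> nat \<Rightarrow> nat \<Rightarrow> nat list \<Rightarrow> nat" where
  "word_code n m = foldl (\<lambda>p k. n + m * p + (k - 1))"

lemma word_code_Nil [simp]: "word_code n m i [] = i"
  and word_code_snoc: "word_code n m i (w @ [k]) = n + m * word_code n m i w + (k - 1)"
  by (simp_all add: word_code_def)

text \<open>Codes below \<open>n\<close> are the bare roots. From any other code the last letter is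
  recovered as a remainder modulo \<open>m\<close> and the code of the shorter word as the quotient;
  letters start at 1 and remainders at 0.\<close>

lemma word_code_inj:
  assumes "i < n" "i' < n" "w \<in> lists {1..m}" "w' \<in> lists {1..m}"
    and "word_code n m i w = word_code n m i' w'"
  shows "i = i' \<and> w = w'"
  using assms(3-5)
proof (induction w arbitrary: w' rule: rev_induct)
  case Nil
  then show ?case
    using assms(1,2) by (cases w' rule: rev_cases) (auto simp: word_code_snoc)
next
  case (snoc k w)
  show ?case
  proof (cases w' rule: rev_cases)
    case Nil
    then show ?thesis
      using snoc.prems assms(1,2) by (auto simp: word_code_snoc)
  next
    case (snoc v l)
    have kl: "k - 1 < m" "l - 1 < m" "k \<ge> 1" "l \<ge> 1"
      using snoc snoc.prems by auto
    have "n + m * word_code n m i w + (k - 1) = n + m * word_code n m i' v + (l - 1)"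
      using snoc.prems snoc by (simp add: word_code_snoc)
    then have "word_code n m i w = word_code n m i' v" "k - 1 = l - 1"
      using parent_child[OF kl(1), of n "word_code n m i w"] parent_child[OF kl(2), of n "word_code n m i' v"]
      by simp_all
    then show ?thesis
      using snoc.IH[of v] snoc.prems snoc kl by auto
  qed
qed

lemma word_code_surj:
  assumes "0 < n" "0 < m"
  shows "\<exists>i w. i < n \<and> w \<in> lists {1..m} \<and> a = word_code n m i w"
proof (rule node_induct[OF assms, of _ a])
  fix a assume "a < n"
  then show "\<exists>i w. i < n \<and> w \<in> lists {1..m} \<and> a = word_code n m i w"
    by (intro exI[of _ a] exI[of _ "[]"]) simp
next
  fix p j assume j: "j < m" and "\<exists>i w. i < n \<and> w \<in> lists {1..m} \<and> p = word_code n m i w"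
  then obtain i w where "i < n" "w \<in> lists {1..m}" "p = word_code n m i w"
    by blast
  then show "\<exists>i w. i < n \<and> w \<in> lists {1..m} \<and> n + m * p + j = word_code n m i w"
    using j by (intro exI[of _ i] exI[of _ "w @ [Suc j]"]) (simp add: word_code_snoc)
qed

text \<open>For a number \<open>a\<close> that is not a root, \<open>(a - n) div m\<close> is its
  parent. Closure under left subwords thus becomes closure under parents.\<close>

definition node_forests :: "nat \<Rightarrow> nat \<Rightarrow> nat \<Rightarrow> nat set set" where
  "node_forests d n m =
     {S. finite S \<and> card S = d \<and> (\<forall>a\<in>S. n \<le> a \<longrightarrow> (a - n) div m \<in> S)}"

definition forest_code :: "nat \<Rightarrow> nat \<Rightarrow> nat list set list \<Rightarrow> nat set" where
  "forest_code n m Ss = {word_code n m i w | i w. i < n \<and> w \<in> Ss ! i}"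

lemma tree_nth_forest: "Ss \<in> forests d n m \<Longrightarrow> i < n \<Longrightarrow> tree m (Ss ! i)"
  unfolding forests_def by auto

lemma mem_forest_code:
  assumes "Ss \<in> forests d n m" "i < n" "w \<in> lists {1..m}"
  shows "word_code n m i w \<in> forest_code n m Ss \<longleftrightarrow> w \<in> Ss ! i"
proof
  assume "word_code n m i w \<in> forest_code n m Ss"
  then obtain i' w' where *: "i' < n" "w' \<in> Ss ! i'" "word_code n m i w = word_code n m i' w'"
    unfolding forest_code_def by blast
  moreover have "w' \<in> lists {1..m}"
    using tree_nth_forest[OF assms(1) *(1)] *(2) unfolding tree_def by blast
  ultimately show "w \<in> Ss ! i"
    using word_code_inj[OF assms(2) _ assms(3)] by metis
qed (use assms in \<open>auto simp: forest_code_def\<close>)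

lemma card_forest_code:
  assumes "length Ss = n" "\<And>S. S \<in> set Ss \<Longrightarrow> tree m S"
  shows "finite (forest_code n m Ss)" "card (forest_code n m Ss) = sum_list (map card Ss)"
proof -
  have t: "tree m (Ss ! i)" if "i < n" for i
    using assms that by simp
  have eq: "forest_code n m Ss = (\<lambda>(i, w). word_code n m i w) ` (SIGMA i:{..<n}. Ss ! i)"
    unfolding forest_code_def by auto
  have fin: "finite (SIGMA i:{..<n}. Ss ! i)"
    using t by (auto simp: tree_def)
  have "inj_on (\<lambda>(i, w). word_code n m i w) (SIGMA i:{..<n}. Ss ! i)"
  proof (rule inj_onI)
    fix x y assume xy: "x \<in> (SIGMA i:{..<n}. Ss ! i)" "y \<in> (SIGMA i:{..<n}. Ss ! i)"
      "(case x of (i, w) \<Rightarrow> word_code n m i w) = (case y of (i, w) \<Rightarrow> word_code n m i w)"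
    obtain i w i' w' where eq: "x = (i, w)" "y = (i', w')"
      by (meson surj_pair)
    have *: "i < n" "w \<in> Ss ! i" "i' < n" "w' \<in> Ss ! i'" "word_code n m i w = word_code n m i' w'"
      using xy unfolding eq by simp_all
    have "w \<in> lists {1..m}" "w' \<in> lists {1..m}"
      using t[OF *(1)] t[OF *(3)] * unfolding tree_def by blast+
    then show "x = y"
      using word_code_inj[of i n i' w m w'] * unfolding eq by blast
  qed
  then have "card (forest_code n m Ss) = card (SIGMA i:{..<n}. Ss ! i)"
    unfolding eq by (rule card_image)
  also have "\<dots> = (\<Sum>i<n. card (Ss ! i))"
    using t by (intro card_SigmaI) (auto simp: tree_def)
  also have "\<dots> = sum_list (map card Ss)"
    using assms(1) by (simp add: sum_list_sum_nth atLeast0LessThan)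
  finally show "card (forest_code n m Ss) = sum_list (map card Ss)" .
  show "finite (forest_code n m Ss)"
    unfolding eq using fin by blast
qed

lemma bij_forest_code:
  assumes nm: "0 < n" "0 < m"
  shows "bij_betw (forest_code n m) (forests d n m) (node_forests d n m)"
  unfolding bij_betw_def
proof
  show "inj_on (forest_code n m) (forests d n m)"
  proof (rule inj_onI)
    fix Ss Ts assume Ss: "Ss \<in> forests d n m" and Ts: "Ts \<in> forests d n m"
      and eq: "forest_code n m Ss = forest_code n m Ts"
    have len: "length Ss = n" "length Ts = n"
      using Ss Ts unfolding forests_def by auto
    show "Ss = Ts"
    proof (rule nth_equalityI)
      fix i assume "i < length Ss"
      then have i: "i < n"
        using len by simp
      have "Ss ! i \<subseteq> lists {1..m}" "Ts ! i \<subseteq> lists {1..m}"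
        using tree_nth_forest[OF Ss i] tree_nth_forest[OF Ts i] unfolding tree_def by simp_all
      moreover have "w \<in> Ss ! i \<longleftrightarrow> w \<in> Ts ! i" if "w \<in> lists {1..m}" for w
        using mem_forest_code[OF Ss i that] mem_forest_code[OF Ts i that] eq by simp
      ultimately show "Ss ! i = Ts ! i"
        by blast
    qed (use len in simp)
  qed
  show "forest_code n m ` forests d n m = node_forests d n m"
  proof (intro subset_antisym subsetI)
    fix S assume "S \<in> forest_code n m ` forests d n m"
    then obtain Ss where Ss: "Ss \<in> forests d n m" and S: "S = forest_code n m Ss"
      by blast
    have "(a - n) div m \<in> S" if "a \<in> S" "n \<le> a" for a
    proof -
      obtain i w where iw: "i < n" "w \<in> Ss ! i" "a = word_code n m i w"
        using \<open>a \<in> S\<close> unfolding S forest_code_def by blast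
      have t: "tree m (Ss ! i)"
        using tree_nth_forest[OF Ss iw(1)] .
      show ?thesis
      proof (cases w rule: rev_cases)
        case Nil
        then show ?thesis
          using iw that by simp
      next
        case (snoc w' k)
        then have "k \<in> {1..m}"
          using t iw(2) unfolding tree_def by auto
        then have "(a - n) div m = word_code n m i w'"
          unfolding iw(3) snoc word_code_snoc
          using parent_child[of "k - 1" m n "word_code n m i w'"] by auto
        moreover have "w' \<in> Ss ! i"
          using t iw(2) snoc unfolding tree_def by blast
        ultimately show ?thesis
          using iw(1) unfolding S forest_code_def by blast
      qed
    qed
    then show "S \<in> node_forests d n m"
      using Ss card_forest_code[of Ss n m] unfolding S node_forests_def forests_def by auto
  next
    fix S assume S: "S \<in> node_forests d n m"
    define Ss where "Ss = map (\<lambda>i. {w \<in> lists {1..m}. word_code n m i w \<in> S}) [0..<n]"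
    have nth: "Ss ! i = {w \<in> lists {1..m}. word_code n m i w \<in> S}" if "i < n" for i
      using that unfolding Ss_def by simp
    have len: "length Ss = n"
      unfolding Ss_def by simp
    have code: "forest_code n m Ss = S"
    proof (intro subset_antisym subsetI)
      fix a assume a: "a \<in> S"
      obtain i w where "i < n" "w \<in> lists {1..m}" "a = word_code n m i w"
        using word_code_surj[OF nm] by blast
      then show "a \<in> forest_code n m Ss"
        using a nth unfolding forest_code_def by blast
    qed (use nth in \<open>auto simp: forest_code_def\<close>)
    have "tree m T" if "T \<in> set Ss" for T
    proof -
      obtain i where i: "i < n" and T: "T = {w \<in> lists {1..m}. word_code n m i w \<in> S}"
        using \<open>T \<in> set Ss\<close> unfolding Ss_def by auto
      have "inj_on (word_code n m i) T"
        using word_code_inj[OF i i] unfolding T by (intro inj_onI) blast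
      then have "finite T"
        using S finite_subset[of "word_code n m i ` T" S] finite_imageD[of "word_code n m i" T]
        unfolding T node_forests_def by auto
      \<comment> \<open>Passing to the parent removes one last letter, so the suffix is stripped
        letter by letter.\<close>
      moreover have "w \<in> T" if "w @ w' \<in> T" for w w'
        using that
      proof (induction w' rule: rev_induct)
        case (snoc k w')
        have "k - 1 < m" and *: "word_code n m i (w @ w' @ [k]) \<in> S" "w @ w' \<in> lists {1..m}"
          using snoc.prems nm unfolding T by auto
        then have "(word_code n m i ((w @ w') @ [k]) - n) div m = word_code n m i (w @ w')"
          unfolding word_code_snoc using parent_child by blast
        moreover have "n \<le> word_code n m i ((w @ w') @ [k])"
          unfolding word_code_snoc by simp
        ultimately have "word_code n m i (w @ w') \<in> S"
          using S * unfolding node_forests_def by (metis (mono_tags, lifting) append_assoc mem_Collect_eq)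
        then show ?case
          using snoc.IH * unfolding T by blast
      qed simp
      ultimately show ?thesis
        unfolding tree_def T by blast
    qed
    then have "Ss \<in> forests d n m"
      using len S card_forest_code[of Ss n m] unfolding code node_forests_def forests_def by auto
    then show "S \<in> forest_code n m ` forests d n m"
      using code by blast
  qed
qed

text \<open>Parents are smaller than their children, so the largest node is a leaf. Removing it
  leaves a forest with one node fewer, and it can be put back only as a root or as a child of a
  remaining node, hence in finitely many ways.\<close>

lemma finite_node_forests:
  assumes nm: "0 < n" "0 < m"
  shows "finite (node_forests d n m)"
proof (induction d)
  case 0
  have "node_forests 0 n m \<subseteq> {{}}"
    unfolding node_forests_def by auto
  then show ?case
    by (rule finite_subset) simp
next
  case (Suc d)
  let ?ext = "\<lambda>S. (\<lambda>a. insert a S) ` ({..<n} \<union> (\<lambda>(p, j). n + m * p + j) ` (S \<times> {..<m}))"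
  have "node_forests (Suc d) n m \<subseteq> \<Union> (?ext ` node_forests d n m)"
  proof
    fix S assume S: "S \<in> node_forests (Suc d) n m"
    then have fin: "finite S" "S \<noteq> {}"
      unfolding node_forests_def by auto
    let ?a = "Max S" and ?S = "S - {Max S}"
    have a: "?a \<in> S"
      using fin by simp
    have par: "(b - n) div m \<in> ?S" if "b \<in> S" "n \<le> b" for b
    proof -
      have "(b - n) div m \<noteq> ?a"
        using parent_less[of n b m] nm that Max_ge[OF fin(1) that(1)] by linarith
      then show ?thesis
        using S that unfolding node_forests_def by blast
    qed
    have "?S \<in> node_forests d n m"
      using S a par unfolding node_forests_def by simp
    moreover have "?a \<in> {..<n} \<union> (\<lambda>(p, j). n + m * p + j) ` (?S \<times> {..<m})"
    proof (cases "?a < n")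
      case False
      then show ?thesis
        using par[OF a] nm by (intro UnI2 image_eqI[of _ _ "((?a - n) div m, (?a - n) mod m)"]) auto
    qed simp
    moreover have "insert ?a ?S = S"
      using a by blast
    ultimately show "S \<in> \<Union> (?ext ` node_forests d n m)"
      by (intro UN_I[of ?S] image_eqI[of _ _ ?a]) (simp_all only:)
  qed
  moreover have "finite (?ext S)" if "S \<in> node_forests d n m" for S
    using that unfolding node_forests_def by auto
  ultimately show ?case
    using Suc by (meson finite_UN_I finite_subset)
qed

text \<open>The indicator function of \<open>S\<close> read as a binary number with node 0 as the
  leading digit. Among subsets of \<open>{..N}\<close>, larger weight means lexicographically
  earlier, that is, containing the first node at which two sets differ.\<close>

definition weight :: "nat \<Rightarrow> nat set \<Rightarrow> nat" where
  "weight N S = (\<Sum>a\<in>S. 2 ^ (N - a))"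

lemma sum_pow2_above: "s \<le> N \<Longrightarrow> (\<Sum>a\<in>{s<..N}. 2 ^ (N - a)) < (2::nat) ^ (N - s)"
proof -
  assume s: "s \<le> N"
  have "(\<Sum>a\<in>{s<..N}. 2 ^ (N - a)) = (\<Sum>j<N - s. (2::nat) ^ j)"
    using s by (intro sum.reindex_bij_witness[of _ "\<lambda>j. N - j" "\<lambda>a. N - a"]) auto
  also have "(\<Sum>j<k. (2::nat) ^ j) < 2 ^ k" for k
    by (induction k) auto
  finally show ?thesis .
qed

text \<open>The digits after position \<open>s\<close> together stay below the single digit
  \<open>2 ^ (N - s)\<close>, so what \<open>T\<close> contains beyond \<open>s\<close> cannot
  compensate for missing \<open>s\<close>.\<close>

lemma weight_less:
  assumes S: "S \<subseteq> {..N}" and T: "T \<subseteq> {..N}" and s: "s \<in> S" "s \<notin> T"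
    and below: "\<And>t. t \<in> T \<Longrightarrow> t < s \<Longrightarrow> t \<in> S"
  shows "weight N T < weight N S"
proof -
  have fin: "finite S" "finite T"
    using S T finite_subset by blast+
  have "T = (T \<inter> {..<s}) \<union> (T \<inter> {s<..N})"
  proof -
    have "t \<in> {..<s} \<union> {s<..N}" if "t \<in> T" for t
      using that T s(2) by (cases t s rule: linorder_cases) auto
    then show ?thesis by blast
  qed
  then have "weight N T = weight N ((T \<inter> {..<s}) \<union> (T \<inter> {s<..N}))"
    by simp
  also have "\<dots> = weight N (T \<inter> {..<s}) + weight N (T \<inter> {s<..N})"
    unfolding weight_def using fin by (intro sum.union_disjoint) auto
  also have "weight N (T \<inter> {s<..N}) \<le> weight N {s<..N}"
    unfolding weight_def by (intro sum_mono2) auto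
  also have "weight N {s<..N} < 2 ^ (N - s)"
    unfolding weight_def using sum_pow2_above S s by blast
  also have "weight N (T \<inter> {..<s}) + 2 ^ (N - s) = weight N (insert s (T \<inter> {..<s}))"
    unfolding weight_def using fin by simp
  also have "\<dots> \<le> weight N S"
    unfolding weight_def using fin s below by (intro sum_mono2) auto
  finally show ?thesis
    by simp
qed

section \<open>Greedy bases and the group action\<close>

context vec_space
begin

lemma span_minimal:
  assumes "X \<subseteq> U" "U \<subseteq> carrier_vec n" "0\<^sub>v n \<in> U"
    and "\<And>u w. u \<in> U \<Longrightarrow> w \<in> U \<Longrightarrow> u + w \<in> U" and "\<And>c u. u \<in> U \<Longrightarrow> c \<cdot>\<^sub>v u \<in> U"
  shows "span X \<subseteq> U"
proof (rule span_is_subset[OF assms(1)])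
  show "LinearCombinations.submodule class_ring U V"
    using assms(2-) module_axioms unfolding submodule_def by (simp add: module_vec_simps)
qed

lemma span_subset_span:
  assumes "Y \<subseteq> carrier_vec n" "X \<subseteq> span Y"
  shows "span X \<subseteq> span Y"
  by (rule span_is_subset[OF assms(2) span_is_submodule[OF assms(1)]])

text \<open>The vectors that \<open>M\<close> sends into \<open>span Y\<close> form a subspace, so
  generators suffice.\<close>

lemma mult_mat_vec_span:
  assumes M: "M \<in> carrier_mat n n" and X: "X \<subseteq> carrier_vec n" and Y: "Y \<subseteq> carrier_vec n"
    and MX: "\<And>u. u \<in> X \<Longrightarrow> M *\<^sub>v u \<in> span Y" and w: "w \<in> span X"
  shows "M *\<^sub>v w \<in> span Y"
proof -
  have "span X \<subseteq> {u \<in> carrier_vec n. M *\<^sub>v u \<in> span Y}"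
  proof (rule span_minimal)
    show "0\<^sub>v n \<in> {u \<in> carrier_vec n. M *\<^sub>v u \<in> span Y}"
    proof -
      have "M *\<^sub>v 0\<^sub>v n = 0\<^sub>v n"
        using M by (intro eq_vecI) auto
      then show ?thesis
        using span_is_submodule[OF Y] unfolding submodule_def by (simp add: module_vec_simps)
    qed
    show "u + w \<in> {u \<in> carrier_vec n. M *\<^sub>v u \<in> span Y}"
      if "u \<in> {u \<in> carrier_vec n. M *\<^sub>v u \<in> span Y}" "w \<in> {u \<in> carrier_vec n. M *\<^sub>v u \<in> span Y}" for u w
      using that M Y by (simp add: mult_add_distrib_mat_vec[of _ n n] span_add1)
    show "c \<cdot>\<^sub>v u \<in> {u \<in> carrier_vec n. M *\<^sub>v u \<in> span Y}"
      if "u \<in> {u \<in> carrier_vec n. M *\<^sub>v u \<in> span Y}" for c u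
      using that M Y by (simp add: mult_mat_vec[of _ n n] smult_in_span)
  qed (use X MX in auto)
  then show ?thesis
    using w by blast
qed

definition greedy :: "(nat \<Rightarrow> 'a vec) \<Rightarrow> nat set" where
  "greedy v = {a. v a \<notin> span (v ` {..<a})}"

definition family_mat :: "nat set \<Rightarrow> (nat \<Rightarrow> 'a vec) \<Rightarrow> 'a mat" where
  "family_mat S v = mat_of_cols n (map v (sorted_list_of_set S))"

lemma family_mat_carrier: "finite S \<Longrightarrow> card S = n \<Longrightarrow> family_mat S v \<in> carrier_mat n n"
  unfolding family_mat_def using mat_of_cols_carrier(1)[of n "map v (sorted_list_of_set S)"] by simp

context
  fixes v :: "nat \<Rightarrow> 'a vec"
  assumes v: "\<And>a. v a \<in> carrier_vec n"
begin

text \<open>A skipped vector depends on its predecessors, and by induction each of those depends on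
  selected vectors no later than itself.\<close>

lemma in_span_greedy: "v a \<in> span (v ` (greedy v \<inter> {..a}))"
proof (induction a rule: less_induct)
  case (less a)
  show ?case
  proof (cases "a \<in> greedy v")
    case True
    then show ?thesis
      using v by (intro span_mem) auto
  next
    case False
    have "v b \<in> span (v ` (greedy v \<inter> {..a}))" if "b < a" for b
    proof -
      have "v ` (greedy v \<inter> {..b}) \<subseteq> v ` (greedy v \<inter> {..a})"
        using that by auto
      then show ?thesis
        using less[OF that] span_is_monotone by blast
    qed
    then have "span (v ` {..<a}) \<subseteq> span (v ` (greedy v \<inter> {..a}))"
      using v by (intro span_subset_span) auto
    then show ?thesis
      using False unfolding greedy_def by blast
  qed
qed

lemma span_greedy_below: "span (v ` {..<a}) \<subseteq> span (v ` (greedy v \<inter> {..<a}))"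
proof (rule span_subset_span; safe?)
  fix b assume "b < a"
  then have "v ` (greedy v \<inter> {..b}) \<subseteq> v ` (greedy v \<inter> {..<a})"
    by auto
  then show "v b \<in> span (v ` (greedy v \<inter> {..<a}))"
    using in_span_greedy span_is_monotone by blast
qed (use v in auto)

lemma greedy_lin_indpt: "lin_indpt (v ` (greedy v \<inter> {..<N})) \<and> inj_on v (greedy v \<inter> {..<N})"
proof (induction N)
  case 0
  show ?case
    by (auto simp: finite_lin_indpt2)
next
  case (Suc N)
  let ?X = "v ` (greedy v \<inter> {..<N})"
  show ?case
  proof (cases "N \<in> greedy v")
    case True
    have X: "?X \<subseteq> carrier_vec n"
      using v by auto
    have "span ?X \<subseteq> span (v ` {..<N})"
      by (rule span_is_monotone) auto
    then have nin: "v N \<notin> span ?X"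
      using True unfolding greedy_def by blast
    then have "v N \<notin> ?X"
      using span_mem[OF X] by blast
    moreover have "greedy v \<inter> {..<Suc N} = insert N (greedy v \<inter> {..<N})"
      using True by auto
    ultimately show ?thesis
      using lin_dep_iff_in_span[OF X _ v] Suc nin by auto
  next
    case False
    then have "greedy v \<inter> {..<Suc N} = greedy v \<inter> {..<N}"
      by (auto simp: less_Suc_eq)
    then show ?thesis
      using Suc by simp
  qed
qed

lemma family_mat_nonsingularI:
  assumes S: "finite S" "card S = n" and "inj_on v S" "lin_indpt (v ` S)"
  shows "det (family_mat S v) \<noteq> 0"
proof -
  have cols: "cols (family_mat S v) = map v (sorted_list_of_set S)"
    unfolding family_mat_def using v by (intro cols_mat_of_cols) auto
  have "rank (family_mat S v) = n"
    using assms by (intro lin_indpt_full_rank[OF family_mat_carrier]) (auto simp: cols distinct_map)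
  then show ?thesis
    using det_rank_iff[OF family_mat_carrier[OF S]] by blast
qed

lemma family_mat_nonsingularD:
  assumes S: "finite S" "card S = n" and det: "det (family_mat S v) \<noteq> 0" and a: "a \<in> S"
  shows "v a \<notin> span (v ` (S - {a}))"
proof -
  note M = family_mat_carrier[OF S, of v]
  have cols: "cols (family_mat S v) = map v (sorted_list_of_set S)"
    unfolding family_mat_def using v by (intro cols_mat_of_cols) auto
  have r: "rank (family_mat S v) = n"
    using low_rank_det_zero[OF M det] .
  have dist: "distinct (cols (family_mat S v))"
    using non_distinct_low_rank[OF M] r by auto
  then have inj: "inj_on v S"
    using S by (simp add: cols distinct_map)
  have "lin_indpt (v ` S)"
    using full_rank_lin_indpt[OF M r dist] S by (simp add: cols)
  then have "v a \<notin> span (v ` S - {v a})"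
    using lindep_span[of "v ` S"] S v a by auto
  moreover have "v ` S - {v a} = v ` (S - {a})"
    using inj a by (auto simp: inj_on_def)
  ultimately show ?thesis
    by simp
qed

lemma greedy_basis:
  assumes "span (range v) = carrier_vec n"
  shows "finite (greedy v)" "card (greedy v) = n" "det (family_mat (greedy v) v) \<noteq> 0"
proof -
  \<comment> \<open>Finiteness of \<open>greedy v\<close> is not known yet, so independence bounds
    its initial segments first.\<close>
  have le: "card (greedy v \<inter> {..<N}) \<le> n" for N
  proof -
    have "card (v ` (greedy v \<inter> {..<N})) \<le> dim"
      using greedy_lin_indpt[of N] v by (intro li_le_dim) auto
    then show ?thesis
      using greedy_lin_indpt[of N] by (simp add: card_image dim_is_n)
  qed
  show fin: "finite (greedy v)"
  proof (rule ccontr)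
    assume "infinite (greedy v)"
    then obtain B where B: "finite B" "card B = Suc n" "B \<subseteq> greedy v"
      using infinite_arbitrarily_large by blast
    then obtain N where "B \<subseteq> {..<N}"
      using finite_nat_iff_bounded by blast
    then have "card B \<le> card (greedy v \<inter> {..<N})"
      using B by (intro card_mono) auto
    then show False
      using le[of N] B by simp
  qed
  then obtain N where "greedy v \<subseteq> {..<N}"
    using finite_nat_iff_bounded by blast
  then have N: "greedy v \<inter> {..<N} = greedy v"
    by blast
  note li = greedy_lin_indpt[of N, unfolded N]
  have X: "v ` greedy v \<subseteq> carrier_vec n"
    using v by auto
  have "v a \<in> span (v ` greedy v)" for a
    using in_span_greedy[of a] span_is_monotone[of "v ` (greedy v \<inter> {..a})" "v ` greedy v"] by blast
  then have "span (range v) \<subseteq> span (v ` greedy v)"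
    using X by (intro span_subset_span) auto
  then have "span (v ` greedy v) = carrier_vec n"
    using assms span_closed[OF X] by blast
  then have "basis (v ` greedy v)"
    using li X unfolding basis_def by simp
  then have "card (v ` greedy v) = n"
    using dim_basis fin dim_is_n by simp
  then show "card (greedy v) = n"
    using li by (simp add: card_image)
  then show "det (family_mat (greedy v) v) \<noteq> 0"
    using li fin by (intro family_mat_nonsingularI) auto
qed

text \<open>Consider the first index at which the two sets differ. Were it in \<open>T\<close>, its
  vector would lie in the span of earlier selected vectors; these have their indices in
  \<open>T\<close> as well, against the independence expressed by the determinant.\<close>

lemma greedy_lex_first:
  assumes T: "finite T" "card T = n" and det: "det (family_mat T v) \<noteq> 0" and ne: "T \<noteq> greedy v"
  shows "\<exists>s\<in>greedy v - T. \<forall>t\<in>T. t < s \<longrightarrow> t \<in> greedy v"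
proof -
  define s where "s = (LEAST s. (s \<in> T) \<noteq> (s \<in> greedy v))"
  have s: "(s \<in> T) \<noteq> (s \<in> greedy v)"
    unfolding s_def by (rule LeastI_ex) (use ne in blast)
  have below: "(t \<in> T) = (t \<in> greedy v)" if "t < s" for t
    using not_less_Least that unfolding s_def by blast
  have "s \<notin> T"
  proof
    assume sT: "s \<in> T"
    then have "v s \<in> span (v ` {..<s})"
      using s unfolding greedy_def by blast
    then have "v s \<in> span (v ` (greedy v \<inter> {..<s}))"
      using span_greedy_below by blast
    moreover have "v ` (greedy v \<inter> {..<s}) \<subseteq> v ` (T - {s})"
      using below by auto
    ultimately have "v s \<in> span (v ` (T - {s}))"
      using span_is_monotone by blast
    then show False
      using family_mat_nonsingularD[OF T det sT] by blast
  qed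
  then show ?thesis
    using s below by blast
qed

end

end

text \<open>The solution of \<open>B *\<^sub>v c = w\<close> for invertible \<open>B\<close>. The
  adjugate keeps the entries visibly polynomial up to the denominator \<open>det B\<close>, which is
  what \<open>poly_on_crd\<close> relies on.\<close>

definition cramer :: "'a::field mat \<Rightarrow> 'a vec \<Rightarrow> 'a vec" where
  "cramer B w = (1 / det B) \<cdot>\<^sub>v (adj_mat B *\<^sub>v w)"

lemma cramer_carrier: "B \<in> carrier_mat d d \<Longrightarrow> w \<in> carrier_vec d \<Longrightarrow> cramer B w \<in> carrier_vec d"
  unfolding cramer_def using adj_mat(1)[of B d] by auto

lemma cramer_mult:
  assumes B: "B \<in> carrier_mat d d" "det B \<noteq> 0" and c: "c \<in> carrier_vec d"
  shows "cramer B (B *\<^sub>v c) = c"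
proof -
  have "adj_mat B *\<^sub>v (B *\<^sub>v c) = (det B \<cdot>\<^sub>m 1\<^sub>m d) *\<^sub>v c"
    using adj_mat[OF B(1)] B c by (metis assoc_mult_mat_vec)
  also have "\<dots> = det B \<cdot>\<^sub>v c"
    using c by (intro eq_vecI) auto
  finally show ?thesis
    unfolding cramer_def using B(2) by (simp add: smult_smult_assoc)
qed

lemma cramer_solve:
  assumes B: "B \<in> carrier_mat d d" "det B \<noteq> 0" and u: "u \<in> carrier_vec d"
  shows "B *\<^sub>v cramer B u = u"
proof -
  have "B *\<^sub>v cramer B u = (1 / det B) \<cdot>\<^sub>v (B *\<^sub>v (adj_mat B *\<^sub>v u))"
    unfolding cramer_def using adj_mat(1)[OF B(1)] B u by (intro mult_mat_vec) auto
  also have "B *\<^sub>v (adj_mat B *\<^sub>v u) = (det B \<cdot>\<^sub>m 1\<^sub>m d) *\<^sub>v u"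
    using adj_mat[OF B(1)] B u by (metis assoc_mult_mat_vec)
  also have "\<dots> = det B \<cdot>\<^sub>v u"
    using u by (intro eq_vecI) auto
  finally show ?thesis
    using B(2) by (simp add: smult_smult_assoc)
qed

text \<open>The vector obtained by applying the matrices along a word to a column of
  \<open>f\<close>, indexed by the code of the word. The case \<open>n = 0\<close> is caught for the
  sake of termination: without roots, 0 would be its own parent.\<close>

function node_vec :: "nat \<Rightarrow> nat \<Rightarrow> 'k::field tup \<Rightarrow> nat \<Rightarrow> 'k vec" where
  "node_vec n m x a = (if a < n \<or> n = 0 then col (fst x) a
     else (snd x ! ((a - n) mod m)) *\<^sub>v node_vec n m x ((a - n) div m))"
  by pat_completeness auto
termination
  by (relation "measure (\<lambda>(n, m, x, a). a)") (auto intro: parent_less)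

declare node_vec.simps [simp del]

lemma node_vec_root: "a < n \<Longrightarrow> node_vec n m x a = col (fst x) a"
  by (simp add: node_vec.simps)

lemma node_vec_child:
  "0 < n \<Longrightarrow> j < m \<Longrightarrow> node_vec n m x (n + m * p + j) = (snd x ! j) *\<^sub>v node_vec n m x p"
  using parent_child[of j m n p] by (subst node_vec.simps) simp

lemma rep_points_fst: "x \<in> rep_points d n m \<Longrightarrow> fst x \<in> carrier_mat d n"
  unfolding rep_points_def by auto

lemma rep_points_snd: "x \<in> rep_points d n m \<Longrightarrow> j < m \<Longrightarrow> snd x ! j \<in> carrier_mat d d"
  unfolding rep_points_def by auto

lemma node_vec_carrier:
  assumes "0 < n" "0 < m" and x: "x \<in> rep_points d n m"
  shows "node_vec n m x a \<in> carrier_vec d"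
  by (rule node_induct[OF assms(1,2), of _ a])
    (use rep_points_fst[OF x] rep_points_snd[OF x] assms(1) in
      \<open>auto simp: node_vec_root node_vec_child intro!: mult_mat_vec_carrier[of _ d d]\<close>)

lemma poly_on_node_vec:
  fixes d :: nat
  assumes nm: "0 < n" "0 < m" and i: "i < d"
  shows "poly_on (rep_points d n m) (rep_coords d n m :: ('k::field tup \<Rightarrow> 'k) set)
    (\<lambda>x. node_vec n m x a $ i)"
proof -
  have "\<forall>i<d. poly_on (rep_points d n m) (rep_coords d n m :: ('k tup \<Rightarrow> 'k) set)
    (\<lambda>x. node_vec n m x a $ i)"
  proof (rule node_induct[OF nm, of _ a]; intro allI impI)
    fix a i assume a: "a < n" and i: "i < d"
    have "poly_on (rep_points d n m) (rep_coords d n m) (\<lambda>(f, \<phi>s). f $$ (i, a) :: 'k)"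
      using a i by (intro poly_on_coord) (auto simp: rep_coords_def)
    then show "poly_on (rep_points d n m) (rep_coords d n m) (\<lambda>x. node_vec n m x a $ i :: 'k)"
      by (rule poly_on_cong) (use a i in \<open>auto simp: node_vec_root rep_points_def\<close>)
  next
    fix p j i assume j: "j < m" and i: "i < d"
      and IH: "\<forall>i<d. poly_on (rep_points d n m) (rep_coords d n m) (\<lambda>x. node_vec n m x p $ i :: 'k)"
    have c: "poly_on (rep_points d n m) (rep_coords d n m) (\<lambda>(f, \<phi>s). (\<phi>s ! j) $$ (i, k) :: 'k)"
      if "k < d" for k
      using j i that by (intro poly_on_coord) (auto simp: rep_coords_def)
    have "poly_on (rep_points d n m) (rep_coords d n m)
        (\<lambda>x. \<Sum>k<d. (case x of (f, \<phi>s) \<Rightarrow> (\<phi>s ! j) $$ (i, k)) * node_vec n m x p $ k :: 'k)"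
      using IH c by (intro poly_on_sum poly_on_mult) auto
    then show "poly_on (rep_points d n m) (rep_coords d n m) (\<lambda>x. node_vec n m x (n + m * p + j) $ i :: 'k)"
    proof (rule poly_on_cong)
      fix x :: "'k tup" assume x: "x \<in> rep_points d n m"
      have "snd x ! j \<in> carrier_mat d d" "node_vec n m x p \<in> carrier_vec d"
        using rep_points_snd[OF x j] node_vec_carrier[OF nm x] .
      then show "(\<Sum>k<d. (case x of (f, \<phi>s) \<Rightarrow> (\<phi>s ! j) $$ (i, k)) * node_vec n m x p $ k)
        = node_vec n m x (n + m * p + j) $ i"
        using i by (simp add: node_vec_child[OF nm(1) j] scalar_prod_def case_prod_beta
            atLeast0LessThan)
    qed
  qed
  then show ?thesis
    using i by blast
qed

section \<open>The general linear group acting on tuples\<close>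

lemma GL_monoid: "Group.monoid (ring_mat TYPE('k::field) d ())"
  using ring.is_monoid[OF ring_mat] .

lemma GL_group: "Group.group (GL d :: 'k::field mat monoid)"
  unfolding GL_def by (rule monoid.units_group[OF GL_monoid])

lemma carrier_GL: "carrier (GL d) = Units (ring_mat TYPE('k::field) d ())"
  and mult_GL: "g \<otimes>\<^bsub>GL d\<^esub> h = (g * h :: 'k mat)"
  and one_GL: "\<one>\<^bsub>GL d\<^esub> = (1\<^sub>m d :: 'k mat)"
  by (simp_all add: GL_def units_of_def ring_mat_def)

lemma GL_carrier_mat: "g \<in> carrier (GL d) \<Longrightarrow> (g :: 'k::field mat) \<in> carrier_mat d d"
  unfolding carrier_GL Units_def ring_mat_def by simp

lemma GL_det: "g \<in> carrier (GL d) \<Longrightarrow> det (g :: 'k::field mat) \<noteq> 0"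
  unfolding carrier_GL by (rule unit_imp_det_non_zero)

lemma GL_inv:
  fixes g :: "'k::field mat"
  assumes "g \<in> carrier (GL d)"
  shows "inv\<^bsub>GL d\<^esub> g \<in> carrier (GL d)" "inv\<^bsub>GL d\<^esub> g * g = 1\<^sub>m d" "g * inv\<^bsub>GL d\<^esub> g = 1\<^sub>m d"
  using group.inv_closed[OF GL_group assms] group.l_inv[OF GL_group assms] group.r_inv[OF GL_group assms]
  by (simp_all add: mult_GL one_GL)

lemma GL_act_rep_points:
  assumes "g \<in> carrier (GL d)" "x \<in> rep_points d n m"
  shows "GL_act d g x \<in> rep_points d n m"
  using assms GL_carrier_mat[OF assms(1)] GL_carrier_mat[OF GL_inv(1)[OF assms(1)]]
  unfolding rep_points_def GL_act_def by (auto intro!: mult_carrier_mat[of _ d d])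

lemma GL_act_mult:
  assumes g: "g \<in> carrier (GL d)" and h: "h \<in> carrier (GL d)" and x: "x \<in> rep_points d n m"
  shows "GL_act d h (GL_act d g x) = GL_act d (h * g) x"
proof -
  obtain f \<phi>s where eq: "x = (f, \<phi>s)"
    by fastforce
  note c = GL_carrier_mat[OF g] GL_carrier_mat[OF h] GL_carrier_mat[OF GL_inv(1)[OF g]]
    GL_carrier_mat[OF GL_inv(1)[OF h]]
  have inv: "inv\<^bsub>GL d\<^esub> (h * g) = inv\<^bsub>GL d\<^esub> g * inv\<^bsub>GL d\<^esub> h"
    using group.inv_mult_group[OF GL_group h g] by (simp add: mult_GL)
  have "h * (g * \<phi> * inv\<^bsub>GL d\<^esub> g) * inv\<^bsub>GL d\<^esub> h = h * g * \<phi> * inv\<^bsub>GL d\<^esub> (h * g)"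
    if "\<phi> \<in> set \<phi>s" for \<phi>
  proof -
    have "\<phi> \<in> carrier_mat d d"
      using that x eq unfolding rep_points_def by auto
    then show ?thesis
      unfolding inv using c by (simp add: assoc_mult_mat[of _ d d _ d _ d])
  qed
  moreover have "h * (g * f) = h * g * f"
    using c x eq unfolding rep_points_def by (simp add: assoc_mult_mat[of _ d d _ d _ n])
  ultimately show ?thesis
    unfolding GL_act_def eq by simp
qed

lemma GL_act_one:
  fixes x :: "'k::field tup"
  assumes "x \<in> rep_points d n m"
  shows "GL_act d (1\<^sub>m d) x = x"
proof -
  have "inv\<^bsub>GL d\<^esub> (1\<^sub>m d) = (1\<^sub>m d :: 'k mat)"
    using monoid.inv_one[OF group.is_monoid[OF GL_group], of d] unfolding one_GL .
  then show ?thesis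
    using assms unfolding rep_points_def GL_act_def
    by (auto intro!: map_idI simp: subset_iff)
qed

lemma one_mem_GL: "1\<^sub>m d \<in> carrier (GL d)"
  using monoid.one_closed[OF group.is_monoid[OF GL_group]] unfolding one_GL .

lemma orbit_GL_act:
  assumes g: "g \<in> carrier (GL d)" and x: "x \<in> rep_points d n m"
  shows "orbit (GL d) (GL_act d) (GL_act d g x) = orbit (GL d) (GL_act d) x"
proof -
  have closed: "h * g \<in> carrier (GL d)" if "g \<in> carrier (GL d)" "h \<in> carrier (GL d)" for g h :: "'a mat"
    using monoid.m_closed[OF group.is_monoid[OF GL_group] that(2,1)] by (simp add: mult_GL)
  have sub: "orbit (GL d) (GL_act d) (GL_act d g y) \<subseteq> orbit (GL d) (GL_act d) y"
    if g: "g \<in> carrier (GL d)" and y: "y \<in> rep_points d n m" for g and y :: "'a tup"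
    unfolding orbit_def using GL_act_mult[OF g _ y] closed[OF g] by auto
  have "GL_act d (inv\<^bsub>GL d\<^esub> g) (GL_act d g x) = x"
    unfolding GL_act_mult[OF g GL_inv(1)[OF g] x] GL_inv(2)[OF g] by (rule GL_act_one[OF x])
  then have "orbit (GL d) (GL_act d) x \<subseteq> orbit (GL d) (GL_act d) (GL_act d g x)"
    using sub[OF GL_inv(1)[OF g] GL_act_rep_points[OF g x]] by simp
  with sub[OF g x] show ?thesis
    by blast
qed

lemma orbit_eqD:
  assumes "y \<in> rep_points d n m" "orbit (GL d) (GL_act d) x = orbit (GL d) (GL_act d) y"
  obtains g where "g \<in> carrier (GL d)" "y = GL_act d g x"
proof -
  have "y \<in> orbit (GL d) (GL_act d) y"
    unfolding orbit_def using GL_act_one[OF assms(1)] one_mem_GL by force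
  then show ?thesis
    using assms(2) that unfolding orbit_def by auto
qed

text \<open>The inverse at the end of each conjugated matrix cancels the factor in front of the
  parent's vector, so exactly one factor \<open>g\<close> survives at every node.\<close>

lemma node_vec_GL_act:
  assumes nm: "0 < n" "0 < m" and g: "g \<in> carrier (GL d)" and x: "x \<in> rep_points d n m"
  shows "node_vec n m (GL_act d g x) a = g *\<^sub>v node_vec n m x a"
proof (rule node_induct[OF nm, of _ a])
  fix a assume "a < n"
  then show "node_vec n m (GL_act d g x) a = g *\<^sub>v node_vec n m x a"
    using GL_carrier_mat[OF g] rep_points_fst[OF x]
    by (auto simp: node_vec_root GL_act_def case_prod_beta intro!: col_mult2[of _ d d _ n])
next
  fix p j assume j: "j < m" and IH: "node_vec n m (GL_act d g x) p = g *\<^sub>v node_vec n m x p"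
  let ?v = "node_vec n m x p" and ?\<phi> = "snd x ! j" and ?h = "inv\<^bsub>GL d\<^esub> g"
  note c = GL_carrier_mat[OF g] GL_carrier_mat[OF GL_inv(1)[OF g]] rep_points_snd[OF x j]
    node_vec_carrier[OF nm x, of p]
  have "snd (GL_act d g x) ! j = g * ?\<phi> * ?h"
    using j x by (auto simp: GL_act_def rep_points_def)
  then have "node_vec n m (GL_act d g x) (n + m * p + j) = (g * ?\<phi> * ?h) *\<^sub>v (g *\<^sub>v ?v)"
    by (simp add: node_vec_child[OF nm(1) j] IH)
  also have "\<dots> = (g * ?\<phi>) *\<^sub>v ((?h * g) *\<^sub>v ?v)"
    using c by (simp add: assoc_mult_mat_vec[of _ d d _ d])
  also have "\<dots> = g *\<^sub>v (?\<phi> *\<^sub>v ?v)"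
    using c by (simp add: GL_inv(2)[OF g] assoc_mult_mat_vec[of _ d d _ d])
  finally show "node_vec n m (GL_act d g x) (n + m * p + j) = g *\<^sub>v node_vec n m x (n + m * p + j)"
    by (simp add: node_vec_child[OF nm(1) j])
qed

section \<open>The cell of a forest\<close>

lemma mult_mat_unit_vec:
  assumes "(M :: 'a::semiring_1 mat) \<in> carrier_mat r c" "k < c"
  shows "M *\<^sub>v unit_vec c k = col M k"
  using assms by (intro eq_vecI) auto

lemma generated_subspace_node_vec:
  assumes nm: "0 < n" "0 < m" and x: "x \<in> rep_points d n m"
  shows "node_vec n m x a \<in> generated_subspace d n x"
proof -
  obtain f \<phi>s where eq: "x = (f, \<phi>s)"
    by fastforce
  have f: "f \<in> carrier_mat d n" and \<phi>s: "length \<phi>s = m"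
    using x eq unfolding rep_points_def by auto
  have "node_vec n m x a \<in> U" if U: "\<forall>v\<in>carrier_vec n. f *\<^sub>v v \<in> U"
    "\<forall>\<phi>\<in>set \<phi>s. \<forall>w\<in>U. \<phi> *\<^sub>v w \<in> U" for U
  proof (rule node_induct[OF nm, of _ a])
    fix a assume a: "a < n"
    have "f *\<^sub>v unit_vec n a \<in> U"
      using U(1) by auto
    then show "node_vec n m x a \<in> U"
      using mult_mat_unit_vec[OF f a] a by (simp add: node_vec_root eq)
  next
    fix p j assume "j < m" "node_vec n m x p \<in> U"
    then show "node_vec n m x (n + m * p + j) \<in> U"
      using U(2) \<phi>s by (simp add: node_vec_child[OF nm(1)] eq)
  qed
  then show ?thesis
    unfolding generated_subspace_def eq by auto
qed

text \<open>The span contains the image of \<open>f\<close>, and the \<open>j\<close>-th matrix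
  carries the vector of \<open>p\<close> to that of its \<open>j\<close>-th child, so the span is
  invariant and contains the generated subspace. In this context \<open>n\<close> is the dimension
  of the ambient space and \<open>m'\<close> the number of roots.\<close>

lemma (in vec_space) span_node_vec_stable:
  assumes nm: "0 < m'" "0 < m" and x: "x \<in> stable_points n m' m"
  shows "span (range (node_vec m' m x)) = carrier_vec n"
proof -
  let ?v = "node_vec m' m x"
  have xr: "x \<in> rep_points n m' m" and gen: "generated_subspace n m' x = carrier_vec n"
    using x unfolding stable_points_def by auto
  obtain f \<phi>s where eq: "x = (f, \<phi>s)"
    by fastforce
  have f: "f \<in> carrier_mat n m'" and \<phi>s: "length \<phi>s = m"
    using xr eq unfolding rep_points_def by auto
  have v: "range ?v \<subseteq> carrier_vec n"
    using node_vec_carrier[OF nm xr] by auto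
  have cols: "set (cols f) \<subseteq> range ?v"
  proof
    fix u assume "u \<in> set (cols f)"
    then obtain i where "i < m'" "u = col f i"
      using f by (auto simp: cols_def)
    then have "u = ?v i"
      by (simp add: node_vec_root eq)
    then show "u \<in> range ?v"
      by blast
  qed
  have "f *\<^sub>v w \<in> span (range ?v)" if w: "w \<in> carrier_vec m'" for w
  proof -
    have "f *\<^sub>v w \<in> col_space f"
      unfolding col_space_eq[OF f] using f w by auto
    then show ?thesis
      using span_is_monotone[OF cols] unfolding col_space_def by blast
  qed
  moreover have "\<phi> *\<^sub>v w \<in> span (range ?v)" if \<phi>: "\<phi> \<in> set \<phi>s" and w: "w \<in> span (range ?v)" for \<phi> w
  proof -
    obtain j where j: "j < m" "\<phi> = snd x ! j"
      using \<phi> \<phi>s eq by (auto simp: in_set_conv_nth)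
    then have "\<phi> *\<^sub>v ?v p = ?v (m' + m * p + j)" for p
      by (simp add: node_vec_child[OF nm(1)])
    then have "\<phi> *\<^sub>v u \<in> span (range ?v)" if "u \<in> range ?v" for u
      using that span_mem[OF v] by auto
    then show ?thesis
      using mult_mat_vec_span[OF _ v v _ w] rep_points_snd[OF xr j(1)] j(2) by blast
  qed
  ultimately have "generated_subspace n m' x \<subseteq> span (range ?v)"
    using span_is_subspace[OF v] unfolding generated_subspace_def eq by auto
  then show ?thesis
    using gen span_closed[OF v] by blast
qed

text \<open>If the vector of \<open>p\<close> depends on vectors of some \<open>b < p\<close>,
  applying the \<open>j\<close>-th matrix makes the \<open>j\<close>-th child of \<open>p\<close>
  depend on the \<open>j\<close>-th children of these \<open>b\<close>, which precede it in the
  numbering. A parent that is not greedy thus has no greedy child.\<close>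

lemma (in vec_space) greedy_node_vec_forest:
  assumes nm: "0 < r" "0 < m" and x: "x \<in> stable_points n r m"
  shows "greedy (node_vec r m x) \<in> node_forests n r m"
    and "det (family_mat (greedy (node_vec r m x)) (node_vec r m x)) \<noteq> 0"
proof -
  let ?v = "node_vec r m x"
  have xr: "x \<in> rep_points n r m"
    using x unfolding stable_points_def by auto
  have v: "?v a \<in> carrier_vec n" for a
    by (rule node_vec_carrier[OF nm xr])
  note basis = greedy_basis[OF v span_node_vec_stable[OF nm x]]
  show "det (family_mat (greedy ?v) ?v) \<noteq> 0"
    by (rule basis(3))
  have "(a - r) div m \<in> greedy ?v" if a: "a \<in> greedy ?v" "r \<le> a" for a
  proof (rule ccontr)
    assume p: "(a - r) div m \<notin> greedy ?v"
    let ?p = "(a - r) div m" and ?j = "(a - r) mod m"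
    have j: "?j < m" and ap: "a = r + m * ?p + ?j"
      using nm a(2) by simp_all
    have "snd x ! ?j *\<^sub>v ?v ?p \<in> span (?v ` {..<a})"
    proof (rule mult_mat_vec_span)
      show "snd x ! ?j \<in> carrier_mat n n"
        by (rule rep_points_snd[OF xr j])
      show "?v ?p \<in> span (?v ` {..<?p})"
        using p unfolding greedy_def by blast
      fix u assume "u \<in> ?v ` {..<?p}"
      then obtain b where b: "b < ?p" "u = ?v b"
        by blast
      have "m * Suc b \<le> m * ?p"
        using b(1) by (intro mult_le_mono2) simp
      then have "m + m * b \<le> m * ?p"
        by simp
      then have "r + m * b + ?j < a"
        using j ap by linarith
      then have "?v (r + m * b + ?j) \<in> span (?v ` {..<a})"
        using v by (intro span_mem) auto
      then show "snd x ! ?j *\<^sub>v u \<in> span (?v ` {..<a})"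
        unfolding b(2) node_vec_child[OF nm(1) j] .
    qed (use v in auto)
    then have "?v a \<in> span (?v ` {..<a})"
      using node_vec_child[OF nm(1) j, of x ?p] ap by metis
    then show False
      using a(1) unfolding greedy_def by blast
  qed
  then show "greedy ?v \<in> node_forests n r m"
    using basis unfolding node_forests_def by auto
qed

locale forest_cell = vec_space f_ty d for f_ty :: "'k::field itself" and d :: nat +
  fixes n m :: nat and S :: "nat set"
  assumes nm: "0 < n" "0 < m" and S: "S \<in> node_forests d n m"
begin

abbreviation "nv \<equiv> node_vec n m :: 'k tup \<Rightarrow> nat \<Rightarrow> 'k vec"
abbreviation "L \<equiv> sorted_list_of_set S"
abbreviation "B x \<equiv> family_mat S (nv x)"

lemma finite_S: "finite S" and card_S: "card S = d" and parent_S: "a \<in> S \<Longrightarrow> n \<le> a \<Longrightarrow> (a - n) div m \<in> S"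
  using S unfolding node_forests_def by auto

lemma length_L: "length L = d"
  using card_S by simp

lemma L_nth_mem: "k < d \<Longrightarrow> L ! k \<in> S"
  using nth_mem[of k L] length_L finite_S by simp

lemma L_nth_ex: "a \<in> S \<Longrightarrow> \<exists>k<d. L ! k = a"
  using in_set_conv_nth[of a L] length_L finite_S by auto

lemma L_inj: "i < d \<Longrightarrow> k < d \<Longrightarrow> L ! i = L ! k \<longleftrightarrow> i = k"
  using nth_eq_iff_index_eq[of L i k] length_L finite_S by simp

lemma B_carrier: "B x \<in> carrier_mat d d"
  by (rule family_mat_carrier[OF finite_S card_S])

lemma B_index: "i < d \<Longrightarrow> k < d \<Longrightarrow> B x $$ (i, k) = nv x (L ! k) $ i"
  unfolding family_mat_def using length_L by (simp add: mat_of_cols_def)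

lemma B_unit_vec:
  assumes "k < d" "x \<in> rep_points d n m"
  shows "B x *\<^sub>v unit_vec d k = nv x (L ! k)"
proof -
  have "col (B x) k = nv x (L ! k)"
    using assms B_carrier[of x] node_vec_carrier[OF nm assms(2), of "L ! k"]
    by (intro eq_vecI) (auto simp: B_index)
  then show ?thesis
    using mult_mat_unit_vec[OF B_carrier assms(1)] by simp
qed

lemma B_GL_act:
  assumes g: "g \<in> carrier (GL d)" and x: "x \<in> rep_points d n m"
  shows "B (GL_act d g x) = g * B x"
proof (rule eq_matI)
  note c = GL_carrier_mat[OF g] B_carrier
  fix i k assume "i < dim_row (g * B x)" "k < dim_col (g * B x)"
  then have ik: "i < d" "k < d"
    using c(1) c(2)[of x] by auto
  have "col (B x) k = nv x (L ! k)"
    using B_unit_vec[OF ik(2) x] mult_mat_unit_vec[OF B_carrier ik(2)] by simp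
  then show "B (GL_act d g x) $$ (i, k) = (g * B x) $$ (i, k)"
    using ik c(1) c(2)[of x] by (simp add: B_index node_vec_GL_act[OF nm g x])
qed (use GL_carrier_mat[OF g] B_carrier[of x] B_carrier[of "GL_act d g x"] in auto)

text \<open>Roots index the columns of \<open>f\<close>, and children of \<open>S\<close> the images
  of the basis vectors under the matrices. When the vectors at \<open>S\<close> are the standard
  basis, the vectors at these indices determine the tuple.\<close>

definition nodes :: "nat set" where
  "nodes = {..<n} \<union> (\<lambda>(p, j). n + m * p + j) ` (S \<times> {..<m})"

lemma S_subset_nodes: "S \<subseteq> nodes"
proof
  fix a assume a: "a \<in> S"
  show "a \<in> nodes"
  proof (cases "a < n")
    case False
    then show ?thesis
      using parent_S[OF a] nm unfolding nodes_def
      by (intro UnI2 image_eqI[of _ _ "((a - n) div m, (a - n) mod m)"]) auto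
  qed (simp add: nodes_def)
qed

lemma child_mem_nodes:
  assumes "j < m"
  shows "n + m * p + j \<in> nodes \<longleftrightarrow> p \<in> S"
proof
  assume "n + m * p + j \<in> nodes"
  then obtain q i where "q \<in> S" "i < m" "n + m * p + j = n + m * q + i"
    unfolding nodes_def by auto
  then show "p \<in> S"
    using parent_child[OF assms, of n p] parent_child[of i m n q] by metis
qed (use assms in \<open>auto simp: nodes_def intro!: image_eqI[of _ _ "(p, j)"]\<close>)

text \<open>
  On the cell, the only nonconstant matrix entries of the normal form of a point are the
  coefficients of a new vector \<open>a \<in> nodes - S\<close> at the earlier basis vectors.
\<close>

definition slots :: "(nat \<times> nat) list" where
  "slots = (SOME xs. set xs = {(a, k). a \<in> nodes - S \<and> k < d \<and> L ! k < a} \<and> distinct xs)"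

lemma slots: "set slots = {(a, k). a \<in> nodes - S \<and> k < d \<and> L ! k < a}" "distinct slots"
proof -
  have "{(a, k). a \<in> nodes - S \<and> k < d \<and> L ! k < a} \<subseteq> nodes \<times> {..<d}"
    by auto
  moreover have "finite (nodes \<times> {..<d})"
    using finite_S unfolding nodes_def by simp
  ultimately have "finite {(a, k). a \<in> nodes - S \<and> k < d \<and> L ! k < a}"
    by (rule finite_subset)
  from someI_ex[OF finite_distinct_list[OF this]]
  show "set slots = {(a, k). a \<in> nodes - S \<and> k < d \<and> L ! k < a}" "distinct slots"
    unfolding slots_def by auto
qed

definition N :: nat where "N = length slots"

definition slot :: "nat \<Rightarrow> nat \<Rightarrow> nat" where
  "slot a k = (SOME i. i < N \<and> slots ! i = (a, k))"

lemma slot: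
  assumes "a \<in> nodes" "a \<notin> S" "k < d" "L ! k < a"
  shows "slot a k < N" "slots ! slot a k = (a, k)"
proof -
  have "(a, k) \<in> set slots"
    using assms slots by simp
  then have "\<exists>i. i < N \<and> slots ! i = (a, k)"
    unfolding N_def by (simp add: in_set_conv_nth)
  from someI_ex[OF this] show "slot a k < N" "slots ! slot a k = (a, k)"
    unfolding slot_def by auto
qed

lemma slot_nth:
  assumes "i < N" "slots ! i = (a, k)"
  shows "a \<in> nodes" "a \<notin> S" "k < d" "L ! k < a" "slot a k = i"
proof -
  have "(a, k) \<in> set slots"
    using assms nth_mem unfolding N_def by metis
  then show *: "a \<in> nodes" "a \<notin> S" "k < d" "L ! k < a"
    using slots by auto
  show "slot a k = i"
    using slot[OF *] assms nth_eq_iff_index_eq[OF slots(2)] unfolding N_def by metis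
qed

text \<open>Coordinates with respect to the basis indexed by \<open>S\<close>. Outside
  \<open>S\<close> the entries at later basis vectors are zero, since otherwise the vector would
  itself have been selected.\<close>

definition normal_vec :: "'k vec \<Rightarrow> nat \<Rightarrow> 'k vec" where
  "normal_vec w a = vec d (\<lambda>k. if a \<in> S then if L ! k = a then 1 else 0
     else if L ! k < a then w $ slot a k else 0)"

text \<open>Column \<open>k\<close> of the \<open>j\<close>-th matrix is the image of the
  \<open>k\<close>-th basis vector, so it belongs to the \<open>j\<close>-th child of
  \<open>L ! k\<close>.\<close>

definition normal_form :: "'k vec \<Rightarrow> 'k tup" where
  "normal_form w = (mat d n (\<lambda>(i, j). normal_vec w j $ i),
     map (\<lambda>j. mat d d (\<lambda>(i, k). normal_vec w (n + m * L ! k + j) $ i)) [0..<m])"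

definition crd :: "'k tup \<Rightarrow> 'k vec" where
  "crd x = vec N (\<lambda>i. cramer (B x) (nv x (fst (slots ! i))) $ snd (slots ! i))"

lemma normal_vec_dim: "normal_vec w a \<in> carrier_vec d"
  unfolding normal_vec_def by simp

lemma normal_vec_basis: "k < d \<Longrightarrow> normal_vec w (L ! k) = unit_vec d k"
  using L_nth_mem L_inj by (intro eq_vecI) (auto simp: normal_vec_def)

lemma normal_form_rep: "normal_form w \<in> rep_points d n m"
  unfolding normal_form_def rep_points_def by auto

lemma col_fst_normal_form: "j < n \<Longrightarrow> col (fst (normal_form w)) j = normal_vec w j"
  using normal_vec_dim[of w j] by (intro eq_vecI) (auto simp: normal_form_def)

lemma col_snd_normal_form:
  "j < m \<Longrightarrow> k < d \<Longrightarrow> col (snd (normal_form w) ! j) k = normal_vec w (n + m * L ! k + j)"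
  using normal_vec_dim[of w "n + m * L ! k + j"] by (intro eq_vecI) (auto simp: normal_form_def)

lemma rep_points_eqI:
  assumes x: "x \<in> rep_points d n m" and y: "y \<in> rep_points d n m"
    and f: "\<And>j. j < n \<Longrightarrow> col (fst x) j = col (fst y) j"
    and \<phi>: "\<And>j k. j < m \<Longrightarrow> k < d \<Longrightarrow> col (snd x ! j) k = col (snd y ! j) k"
  shows "x = y"
proof (rule prod_eqI)
  show "fst x = fst y"
    using rep_points_fst[OF x] rep_points_fst[OF y] f by (intro mat_col_eqI) auto
  show "snd x = snd y"
  proof (rule nth_equalityI)
    show "length (snd x) = length (snd y)"
      using x y unfolding rep_points_def by auto
    fix j assume "j < length (snd x)"
    then have j: "j < m"
      using x unfolding rep_points_def by auto
    show "snd x ! j = snd y ! j"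
      using rep_points_snd[OF x j] rep_points_snd[OF y j] \<phi>[OF j] by (intro mat_col_eqI) auto
  qed
qed

text \<open>The parent of a node that is not a root lies in \<open>S\<close>, where the vector is
  already a unit vector, so the matrix just returns the prescribed column.\<close>

lemma node_vec_normal_form: "a \<in> nodes \<Longrightarrow> nv (normal_form w) a = normal_vec w a"
proof -
  have "a \<in> nodes \<longrightarrow> nv (normal_form w) a = normal_vec w a"
  proof (rule node_induct[OF nm, of _ a])
    fix a assume "a < n"
    then show "a \<in> nodes \<longrightarrow> nv (normal_form w) a = normal_vec w a"
      by (simp add: node_vec_root col_fst_normal_form)
  next
    fix p j assume j: "j < m" and IH: "p \<in> nodes \<longrightarrow> nv (normal_form w) p = normal_vec w p"
    show "n + m * p + j \<in> nodes \<longrightarrow> nv (normal_form w) (n + m * p + j) = normal_vec w (n + m * p + j)"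
    proof
      assume "n + m * p + j \<in> nodes"
      then have p: "p \<in> S"
        using child_mem_nodes[OF j] by simp
      then obtain k where k: "k < d" "L ! k = p"
        using L_nth_ex by blast
      have "nv (normal_form w) p = unit_vec d k"
        using IH p S_subset_nodes normal_vec_basis[OF k(1)] k(2) by auto
      then show "nv (normal_form w) (n + m * p + j) = normal_vec w (n + m * p + j)"
        using mult_mat_unit_vec[OF rep_points_snd[OF normal_form_rep j] k(1)]
          col_snd_normal_form[OF j k(1)] k(2) by (simp add: node_vec_child[OF nm(1) j])
    qed
  qed
  then show "a \<in> nodes \<Longrightarrow> nv (normal_form w) a = normal_vec w a" ..
qed

lemma node_vec_normal_form_basis: "k < d \<Longrightarrow> nv (normal_form w) (L ! k) = unit_vec d k"
  using node_vec_normal_form[of "L ! k" w] L_nth_mem[of k] S_subset_nodes normal_vec_basis[of k w]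
  by auto

lemma normal_vec_above: "k < d \<Longrightarrow> a < L ! k \<Longrightarrow> normal_vec w a $ k = 0"
  unfolding normal_vec_def by auto

text \<open>Triangularity propagates beyond \<open>nodes\<close>. There the parent \<open>p\<close>
  is outside \<open>S\<close>, so by induction its vector involves only basis vectors with
  \<open>L ! i < p\<close>. The matrix sends these to vectors of \<open>j\<close>-th children, which
  precede \<open>a\<close> and hence \<open>L ! k\<close>, and so have no entry at
  \<open>k\<close>.\<close>

lemma node_vec_normal_form_above:
  "k < d \<Longrightarrow> a < L ! k \<Longrightarrow> nv (normal_form w) a $ k = 0"
proof (induction a arbitrary: k rule: less_induct)
  case (less a)
  show ?case
  proof (cases "a \<in> nodes")
    case True
    then show ?thesis
      using less.prems by (simp add: node_vec_normal_form normal_vec_above)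
  next
    case False
    then have "\<not> a < n"
      unfolding nodes_def by auto
    then obtain p j where j: "j < m" and a: "a = n + m * p + j" and p: "p < a"
      using node_cases[OF nm, of a] by metis
    have pS: "p \<notin> S"
      using False child_mem_nodes[OF j] a by simp
    let ?\<phi> = "snd (normal_form w) ! j" and ?v = "nv (normal_form w) p"
    have \<phi>: "?\<phi> \<in> carrier_mat d d" and v: "?v \<in> carrier_vec d"
      using rep_points_snd[OF normal_form_rep j] node_vec_carrier[OF nm normal_form_rep] .
    have "?\<phi> $$ (k, i) * ?v $ i = 0" if i: "i < d" for i
    proof (cases "p < L ! i")
      case True
      then show ?thesis
        using less.IH[OF p i] by simp
    next
      case False
      then have "L ! i < p"
        using L_nth_mem[OF i] pS by (metis linorder_neqE_nat)
      then have "m * Suc (L ! i) \<le> m * p"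
        by (intro mult_le_mono2) simp
      then have "n + m * L ! i + j < L ! k"
        using a j less.prems by simp
      then have "col ?\<phi> i $ k = 0"
        using col_snd_normal_form[OF j i] normal_vec_above[OF less.prems(1)] by simp
      then show ?thesis
        using \<phi> i less.prems(1) by simp
    qed
    then have "(?\<phi> *\<^sub>v ?v) $ k = 0"
      using \<phi> v less.prems(1) by (auto simp: scalar_prod_def intro!: sum.neutral)
    then show ?thesis
      by (simp add: a node_vec_child[OF nm(1) j])
  qed
qed

lemma B_normal_form: "B (normal_form w) = 1\<^sub>m d"
  using B_carrier[of "normal_form w"]
  by (intro eq_matI) (auto simp: B_index node_vec_normal_form_basis)

lemma cramer_one: "u \<in> carrier_vec d \<Longrightarrow> cramer (1\<^sub>m d) u = u"
  using cramer_mult[of "1\<^sub>m d" d u] by simp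

lemma crd_normal_form:
  assumes "w \<in> carrier_vec N"
  shows "crd (normal_form w) = w"
proof (rule eq_vecI)
  fix i assume "i < dim_vec w"
  then have i: "i < N"
    using assms by simp
  obtain a k where ak: "slots ! i = (a, k)"
    by fastforce
  note s = slot_nth[OF i ak]
  have "crd (normal_form w) $ i = normal_vec w a $ k"
    using i ak s(1) by (simp add: crd_def B_normal_form cramer_one normal_vec_dim node_vec_normal_form)
  then show "crd (normal_form w) $ i = w $ i"
    using s unfolding normal_vec_def by simp
qed (use assms in \<open>simp add: crd_def\<close>)

lemma unit_vecs_carrier: "set (unit_vecs d) \<subseteq> U \<Longrightarrow> VectorSpace.subspace class_ring U V \<Longrightarrow> carrier_vec d \<subseteq> U"
  using span_is_subset span_unit_vecs_is_carrier unfolding VectorSpace.subspace_def by metis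

text \<open>Every unit vector occurs as the vector at a node of \<open>S\<close>, so the generated
  subspace is everything.\<close>

lemma normal_form_stable: "normal_form w \<in> stable_points d n m"
proof -
  let ?x = "normal_form w"
  have mem: "unit_vec d k \<in> generated_subspace d n ?x" if "k < d" for k
    using generated_subspace_node_vec[OF nm normal_form_rep, of w "L ! k"]
      node_vec_normal_form_basis[OF that, of w] by simp
  obtain f \<phi>s where eq: "?x = (f, \<phi>s)"
    by fastforce
  have "carrier_vec d \<subseteq> U" if U: "VectorSpace.subspace class_ring U V"
    "\<forall>v\<in>carrier_vec n. f *\<^sub>v v \<in> U" "\<forall>\<phi>\<in>set \<phi>s. \<forall>w\<in>U. \<phi> *\<^sub>v w \<in> U" for U
  proof (rule unit_vecs_carrier[OF _ U(1)])
    have "unit_vec d k \<in> U" if "k < d" for k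
      using mem[OF that] U unfolding eq generated_subspace_def by blast
    then show "set (unit_vecs d) \<subseteq> U"
      unfolding unit_vecs_def by auto
  qed
  then have "carrier_vec d \<subseteq> generated_subspace d n ?x"
    unfolding eq generated_subspace_def by blast
  moreover have "generated_subspace d n ?x \<subseteq> carrier_vec d"
  proof -
    have "VectorSpace.subspace class_ring (span (set (unit_vecs d))) V"
      by (rule span_is_subspace) (auto simp: unit_vecs_def)
    then have "VectorSpace.subspace class_ring (carrier_vec d) V"
      by (simp add: span_unit_vecs_is_carrier)
    moreover have "\<forall>v\<in>carrier_vec n. f *\<^sub>v v \<in> carrier_vec d"
      using normal_form_rep[of w] unfolding eq rep_points_def by auto
    moreover have "\<forall>\<phi>\<in>set \<phi>s. \<forall>w\<in>carrier_vec d. \<phi> *\<^sub>v w \<in> carrier_vec d"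
      using normal_form_rep[of w] unfolding eq rep_points_def by auto
    ultimately show ?thesis
      unfolding eq generated_subspace_def by blast
  qed
  ultimately show ?thesis
    unfolding stable_points_def using normal_form_rep by blast
qed

text \<open>For \<open>a = L ! k\<close> every earlier vector has entry 0 at \<open>k\<close>, while
  the vector at \<open>a\<close> has entry 1. For \<open>a\<close> outside \<open>S\<close> the
  vector combines unit vectors that already occurred at earlier indices of \<open>S\<close>.\<close>

lemma greedy_normal_form: "greedy (nv (normal_form w)) = S"
proof -
  let ?v = "nv (normal_form w)"
  have v: "?v a \<in> carrier_vec d" for a
    by (rule node_vec_carrier[OF nm normal_form_rep])
  have "a \<in> greedy ?v" if a: "a \<in> S" for a
  proof -
    obtain k where k: "k < d" "L ! k = a"
      using L_nth_ex[OF a] by blast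
    have "span (?v ` {..<a}) \<subseteq> {u \<in> carrier_vec d. u $ k = 0}"
      using k v by (intro span_minimal) (auto simp: node_vec_normal_form_above)
    moreover have "?v a $ k = 1"
      using node_vec_normal_form_basis[OF k(1), of w] k by simp
    ultimately show ?thesis
      unfolding greedy_def by auto
  qed
  moreover have "a \<notin> greedy ?v" if a: "a \<notin> S" for a
  proof -
    have X: "?v ` {..<a} \<subseteq> carrier_vec d"
      using v by auto
    \<comment> \<open>The coordinate expansion is built up one entry at a time, so that
      \<open>k = d\<close> gives the vector itself.\<close>
    have "vec d (\<lambda>i. if i < k then ?v a $ i else 0) \<in> span (?v ` {..<a})" if "k \<le> d" for k
      using that
    proof (induction k)
      case 0
      have "vec d (\<lambda>i. if i < 0 then ?v a $ i else 0) = 0\<^sub>v d"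
        by auto
      then show ?case
        using span_is_submodule[OF X] unfolding submodule_def by (simp add: module_vec_simps)
    next
      case (Suc k)
      have "?v a $ k \<cdot>\<^sub>v unit_vec d k \<in> span (?v ` {..<a})"
      proof (cases "L ! k < a")
        case True
        then have "unit_vec d k \<in> ?v ` {..<a}"
          using node_vec_normal_form_basis[of k w] Suc.prems by (intro image_eqI[of _ _ "L ! k"]) auto
        then show ?thesis
          by (intro smult_in_span[OF X] span_mem[OF X])
      next
        case False
        then have "a < L ! k"
          using a L_nth_mem[of k] Suc.prems by (metis Suc_le_lessD linorder_neqE_nat)
        then have "?v a $ k = 0"
          using node_vec_normal_form_above Suc.prems by simp
        moreover have "0 \<cdot>\<^sub>v unit_vec d k = (0\<^sub>v d :: 'k vec)"
          by auto
        ultimately show ?thesis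
          using span_is_submodule[OF X] unfolding submodule_def by (simp add: module_vec_simps)
      qed
      moreover have "vec d (\<lambda>i. if i < Suc k then ?v a $ i else 0) =
        vec d (\<lambda>i. if i < k then ?v a $ i else 0) + ?v a $ k \<cdot>\<^sub>v unit_vec d k"
        using Suc.prems by (intro eq_vecI) (auto simp: less_Suc_eq)
      ultimately show ?case
        using span_add1[OF X] Suc by simp
    qed
    from this[of d] have "vec d (\<lambda>i. if i < d then ?v a $ i else 0) \<in> span (?v ` {..<a})"
      by simp
    moreover have "vec d (\<lambda>i. if i < d then ?v a $ i else 0) = ?v a"
      using v[of a] by (intro eq_vecI) auto
    ultimately show ?thesis
      unfolding greedy_def by simp
  qed
  ultimately show ?thesis
    by blast
qed

end

text \<open>Coordinates with respect to a basis do not change when the basis and the vector are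
  moved by the same \<open>g\<close>.\<close>

lemma cramer_GL:
  assumes g: "g \<in> carrier (GL d)" and B: "B \<in> carrier_mat d d" "det B \<noteq> 0" and u: "u \<in> carrier_vec d"
  shows "cramer (g * B) (g *\<^sub>v u) = cramer B u"
proof -
  note c = GL_carrier_mat[OF g] cramer_carrier[OF B(1) u]
  have "g *\<^sub>v u = (g * B) *\<^sub>v cramer B u"
    using c B u by (simp add: cramer_solve assoc_mult_mat_vec[of _ d d _ d])
  moreover have "det (g * B) \<noteq> 0"
    using det_mult[OF c(1) B(1)] GL_det[OF g] B(2) by simp
  ultimately show ?thesis
    using cramer_mult[of "g * B" d "cramer B u"] c B by simp
qed

section \<open>The chart conditions for the cell of a forest\<close>

context forest_cell
begin

lemma crd_carrier: "crd x \<in> carrier_vec N"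
  unfolding crd_def by simp

lemma poly_on_B:
  assumes "i < d" "k < d"
  shows "poly_on (rep_points d n m) (rep_coords d n m) (\<lambda>x. B x $$ (i, k))"
  using poly_on_node_vec[OF nm assms(1)] by (simp add: B_index assms)

lemma poly_on_det_B: "poly_on (rep_points d n m) (rep_coords d n m) (\<lambda>x. det (B x))"
  by (intro poly_on_det[of _ _ d] B_carrier poly_on_B)

text \<open>Multiplying by the determinant leaves an entry of the adjugate applied to the vector, a
  sum of cofactors times entries. Division by zero makes the left side 0 at singular
  \<open>B x\<close>, where this sum need not vanish, so the claim is restricted to nonzero
  determinant.\<close>

lemma poly_on_crd:
  assumes i: "i < N"
  shows "poly_on {x \<in> rep_points d n m. det (B x) \<noteq> 0} (rep_coords d n m) (\<lambda>x. det (B x) * crd x $ i)"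
proof -
  obtain a k where ak: "slots ! i = (a, k)"
    by fastforce
  note s = slot_nth[OF i ak]
  have "poly_on (rep_points d n m) (rep_coords d n m) (\<lambda>x. \<Sum>l<d. cofactor (B x) l k * nv x a $ l)"
    using s(3) poly_on_B B_carrier
    by (intro poly_on_sum poly_on_mult poly_on_node_vec[OF nm] poly_on_cofactor[of _ _ d]) auto
  then have "poly_on {x \<in> rep_points d n m. det (B x) \<noteq> 0} (rep_coords d n m)
      (\<lambda>x. \<Sum>l<d. cofactor (B x) l k * nv x a $ l)"
    unfolding poly_on_def by blast
  then show ?thesis
  proof (rule poly_on_cong)
    fix x assume "x \<in> {x \<in> rep_points d n m. det (B x) \<noteq> 0}"
    then have x: "x \<in> rep_points d n m" "det (B x) \<noteq> 0"
      by auto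
    have "det (B x) * crd x $ i = (adj_mat (B x) *\<^sub>v nv x a) $ k"
      using i ak s(3) x(2) adj_mat(1)[OF B_carrier[of x]] by (simp add: crd_def cramer_def)
    also have "\<dots> = (\<Sum>l<d. cofactor (B x) l k * nv x a $ l)"
      using s(3) B_carrier[of x] node_vec_carrier[OF nm x(1), of a]
      by (auto simp: adj_mat_def scalar_prod_def atLeast0LessThan intro!: sum.cong)
    finally show "(\<Sum>l<d. cofactor (B x) l k * nv x a $ l) = det (B x) * crd x $ i"
      by simp
  qed
qed

lemma crd_GL_act:
  assumes g: "g \<in> carrier (GL d)" and x: "x \<in> rep_points d n m" and det: "det (B x) \<noteq> 0"
  shows "crd (GL_act d g x) = crd x"
  unfolding crd_def
  by (simp add: B_GL_act[OF g x] node_vec_GL_act[OF nm g x] cramer_GL[OF g B_carrier det]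
      node_vec_carrier[OF nm x])

lemma det_B_GL_act:
  assumes "g \<in> carrier (GL d)" "x \<in> rep_points d n m"
  shows "det (B (GL_act d g x)) = 0 \<longleftrightarrow> det (B x) = 0"
  using det_mult[OF GL_carrier_mat[OF assms(1)] B_carrier, of x] GL_det[OF assms(1)]
  by (simp add: B_GL_act[OF assms])

lemma det_B_orbit:
  assumes "x \<in> rep_points d n m" "y \<in> rep_points d n m"
    and "orbit (GL d) (GL_act d) x = orbit (GL d) (GL_act d) y"
  shows "det (B y) = 0 \<longleftrightarrow> det (B x) = 0"
proof -
  obtain g where "g \<in> carrier (GL d)" "y = GL_act d g x"
    using orbit_eqD[OF assms(2,3)] by blast
  then show ?thesis
    using det_B_GL_act assms(1) by simp
qed

lemma crd_orbit:
  assumes "x \<in> rep_points d n m" "y \<in> rep_points d n m"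
    and "orbit (GL d) (GL_act d) x = orbit (GL d) (GL_act d) y" "det (B x) \<noteq> 0"
  shows "crd y = crd x"
proof -
  obtain g where "g \<in> carrier (GL d)" "y = GL_act d g x"
    using orbit_eqD[OF assms(2,3)] by blast
  then show ?thesis
    using crd_GL_act assms by simp
qed

lemma poly_on_normal_vec:
  assumes a: "a \<in> nodes" and k: "k < d"
  shows "poly_on (carrier_vec N) (vec_coords N) (\<lambda>w. normal_vec w a $ k)"
proof (cases "a \<notin> S \<and> L ! k < a")
  case True
  then have "slot a k < N"
    using slot a k by blast
  then have "poly_on (carrier_vec N) (vec_coords N) (\<lambda>w. w $ slot a k :: 'k)"
    by (intro poly_on_coord) auto
  moreover have "normal_vec w a $ k = w $ slot a k" for w
    using True k by (simp add: normal_vec_def)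
  ultimately show ?thesis
    by simp
next
  case False
  then have "normal_vec w a $ k = (if a \<in> S \<and> L ! k = a then 1 else 0)" for w
    using k by (auto simp: normal_vec_def)
  then show ?thesis
    by (simp add: poly_on_const)
qed

lemma poly_on_normal_form:
  assumes "c \<in> rep_coords d n m"
  shows "poly_on (carrier_vec N) (vec_coords N) (\<lambda>w. c (normal_form w))"
proof -
  consider i j where "i < d" "j < n" "c = (\<lambda>(f, \<phi>s). f $$ (i, j))"
    | k i j where "k < m" "i < d" "j < d" "c = (\<lambda>(f, \<phi>s). (\<phi>s ! k) $$ (i, j))"
    using assms unfolding rep_coords_def by blast
  then show ?thesis
  proof cases
    case 1
    then show ?thesis
      using poly_on_normal_vec[of j i] by (simp add: normal_form_def nodes_def)
  next
    case 2
    then show ?thesis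
      using poly_on_normal_vec[of "n + m * L ! j + k" i] child_mem_nodes[of k "L ! j"] L_nth_mem
      by (simp add: normal_form_def)
  qed
qed

text \<open>Moving \<open>x\<close> by the inverse of \<open>B x\<close> turns the vectors at
  \<open>S\<close> into the standard basis. Greediness then forces the zeros of the normal form, and
  what remains are the coordinates collected in \<open>crd x\<close>.\<close>

lemma orbit_normal_form:
  assumes x: "x \<in> stable_points d n m" and greedy: "greedy (nv x) = S"
  shows "orbit (GL d) (GL_act d) (normal_form (crd x)) = orbit (GL d) (GL_act d) x"
proof -
  have xr: "x \<in> rep_points d n m"
    using x unfolding stable_points_def by auto
  have v: "nv x a \<in> carrier_vec d" for a
    by (rule node_vec_carrier[OF nm xr])
  have det: "det (B x) \<noteq> 0"
    using greedy_node_vec_forest(2)[OF nm x] greedy by simp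
  then have BGL: "B x \<in> carrier (GL d)"
    unfolding carrier_GL by (rule det_non_zero_imp_unit[OF B_carrier])
  define g where "g = inv\<^bsub>GL d\<^esub> (B x)"
  have g: "g \<in> carrier (GL d)" "g * B x = 1\<^sub>m d"
    unfolding g_def using GL_inv[OF BGL] by auto
  define y where "y = GL_act d g x"
  have yr: "y \<in> rep_points d n m"
    unfolding y_def by (rule GL_act_rep_points[OF g(1) xr])
  \<comment> \<open>As \<open>g * B x\<close> is the identity, \<open>cramer_GL\<close> identifies
    each translated vector with the coordinates of the original one in the basis
    \<open>B x\<close>.\<close>
  have nvy: "nv y a = cramer (B x) (nv x a)" for a
  proof -
    have "nv y a = cramer (1\<^sub>m d) (g *\<^sub>v nv x a)"
      unfolding y_def node_vec_GL_act[OF nm g(1) xr]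
      using cramer_one[of "g *\<^sub>v nv x a"] GL_carrier_mat[OF g(1)] v by simp
    then show ?thesis
      using cramer_GL[OF g(1) B_carrier det v] g(2) by simp
  qed
  have basis: "nv y (L ! k) = unit_vec d k" if "k < d" for k
    using cramer_mult[OF B_carrier det, of "unit_vec d k"] B_unit_vec[OF that xr] by (simp add: nvy)
  have above: "nv y a $ k = 0" if k: "k < d" and a: "a < L ! k" for a k
  proof -
    \<comment> \<open>The vector at \<open>a\<close> lies in the span of the selected vectors up to
      \<open>a\<close>. Those are moved by \<open>g\<close> to unit vectors at positions
      \<open>i\<close> with \<open>L ! i \<le> a < L ! k\<close>, so never at
      \<open>k\<close>.\<close>
    let ?U = "{u \<in> carrier_vec d. (g *\<^sub>v u) $ k = 0}"
    note gc = GL_carrier_mat[OF g(1)]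
    have "span (nv x ` (S \<inter> {..a})) \<subseteq> ?U"
    proof (rule span_minimal)
      show "nv x ` (S \<inter> {..a}) \<subseteq> ?U"
      proof clarify
        fix b assume b: "b \<in> S" "b \<le> a"
        then obtain i where i: "i < d" "L ! i = b"
          using L_nth_ex by blast
        then have "(g *\<^sub>v nv x b) $ k = unit_vec d i $ k"
          using basis[OF i(1)] node_vec_GL_act[OF nm g(1) xr, of b] unfolding y_def by simp
        then show "nv x b \<in> carrier_vec d \<and> (g *\<^sub>v nv x b) $ k = 0"
          using v i k a b by auto
      qed
    qed (use gc k in \<open>auto simp: scalar_prod_add_distrib[of _ d] mult_mat_vec[of _ d d]\<close>)
    moreover have "nv x a \<in> span (nv x ` (S \<inter> {..a}))"
      using in_span_greedy[of "nv x" a] v greedy by simp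
    ultimately show ?thesis
      unfolding y_def node_vec_GL_act[OF nm g(1) xr] by blast
  qed
  have normal: "nv y a = normal_vec (crd x) a" if a: "a \<in> nodes" for a
  proof (cases "a \<in> S")
    case True
    then obtain k where "k < d" "L ! k = a"
      using L_nth_ex by blast
    then show ?thesis
      using basis normal_vec_basis by metis
  next
    case False
    show ?thesis
    proof (rule eq_vecI)
      fix k assume "k < dim_vec (normal_vec (crd x) a)"
      then have k: "k < d"
        using normal_vec_dim[of "crd x" a] by simp
      show "nv y a $ k = normal_vec (crd x) a $ k"
      proof (cases "L ! k < a")
        case True
        note s = slot[OF a False k True]
        show ?thesis
          using s True False k by (simp add: normal_vec_def crd_def nvy)
      next
        case F: False
        then have "a < L ! k"
          using False L_nth_mem[OF k] by (metis linorder_neqE_nat)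
        then show ?thesis
          using above[OF k] normal_vec_above[OF k] by simp
      qed
    qed (use node_vec_carrier[OF nm yr, of a] normal_vec_dim[of "crd x" a] in simp)
  qed
  have "y = normal_form (crd x)"
  proof (rule rep_points_eqI[OF yr normal_form_rep])
    fix j assume j: "j < n"
    then show "col (fst y) j = col (fst (normal_form (crd x))) j"
      using normal[of j] by (simp add: nodes_def node_vec_root col_fst_normal_form)
  next
    fix j k assume j: "j < m" and k: "k < d"
    have "col (snd y ! j) k = nv y (n + m * L ! k + j)"
      using mult_mat_unit_vec[OF rep_points_snd[OF yr j] k] basis[OF k]
      by (simp add: node_vec_child[OF nm(1) j])
    then show "col (snd y ! j) k = col (snd (normal_form (crd x)) ! j) k"
      using normal child_mem_nodes[OF j] L_nth_mem[OF k] by (simp add: col_snd_normal_form[OF j k])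
  qed
  then show ?thesis
    using orbit_GL_act[OF g(1) xr] unfolding y_def by simp
qed

definition cell :: "'k tup set set" where
  "cell = orbit (GL d) (GL_act d) ` {x \<in> stable_points d n m. greedy (nv x) = S}"

lemma normal_form_cell: "orbit (GL d) (GL_act d) (normal_form w) \<in> cell"
  unfolding cell_def using normal_form_stable greedy_normal_form by blast

lemma cell_affine_space:
  "isomorphic_fspaces (induced_fspace (nc_hilbert d n m) cell) (affine_space N :: ('k vec, 'k) fspace)"
proof -
  have sr: "stable_points d n m \<subseteq> (rep_points d n m :: 'k tup set)"
    unfolding stable_points_def by blast
  interpret quotient_chart "rep_points d n m" "stable_points d n m" "rep_coords d n m"
    "orbit (GL d) (GL_act d)" cell "\<lambda>x. det (B x)" N crd normal_form
  proof
    show "cell \<subseteq> orbit (GL d) (GL_act d) ` stable_points d n m"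
      unfolding cell_def by blast
    show "det (B y) \<noteq> 0 \<and> crd y = crd x"
      if "x \<in> stable_points d n m" "y \<in> stable_points d n m"
        "orbit (GL d) (GL_act d) x = orbit (GL d) (GL_act d) y" "det (B x) \<noteq> 0" for x y
      using det_B_orbit[of x y] crd_orbit[of x y] that sr by blast
    show "normal_form v \<in> stable_points d n m \<and> det (B (normal_form v)) \<noteq> 0 \<and>
        crd (normal_form v) = v \<and> orbit (GL d) (GL_act d) (normal_form v) \<in> cell"
      if "v \<in> carrier_vec N" for v
      using normal_form_stable normal_form_cell crd_normal_form[OF that] by (simp add: B_normal_form)
    \<comment> \<open>The definition of \<open>cell\<close> gives greedy forest \<open>S\<close>
      only for some representative \<open>y\<close> of the orbit, so the claim is proved at
      \<open>y\<close> and transported by invariance.\<close>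
    fix x :: "'k tup" assume x: "x \<in> stable_points d n m" "orbit (GL d) (GL_act d) x \<in> cell"
    then obtain y where y: "y \<in> stable_points d n m" "greedy (nv y) = S"
      "orbit (GL d) (GL_act d) x = orbit (GL d) (GL_act d) y"
      unfolding cell_def by auto
    have "det (B y) \<noteq> 0"
      using greedy_node_vec_forest(2)[OF nm y(1)] y(2) by simp
    moreover have "x \<in> rep_points d n m" "y \<in> rep_points d n m"
      using x y sr by auto
    ultimately show "det (B x) \<noteq> 0 \<and>
        orbit (GL d) (GL_act d) (normal_form (crd x)) = orbit (GL d) (GL_act d) x"
      using det_B_orbit[of x y] crd_orbit[of y x] orbit_normal_form[OF y(1,2)] y(3) by simp
  qed (use sr crd_carrier poly_on_det_B poly_on_crd poly_on_normal_form in \<open>blast+\<close>)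
  show ?thesis
    using cell_isomorphic_affine_space unfolding nc_hilbert_def rep_space_def .
qed

end

section \<open>The filtration by vanishing determinants\<close>

theorem theorem1p3:
  fixes d n m :: nat
  assumes "m \<ge> 1" and "n \<ge> 1"
  shows "\<exists>u A Z.
    cell_decomposition (nc_hilbert d n m :: ('k::alg_closed_field tup set, 'k) fspace) u A \<and>
    bij_betw Z (forests d n m) (cells u A)"
proof -
  interpret vec_space "TYPE('k)" d .
  have nm: "0 < n" "0 < m"
    using assms by auto
  let ?F = "node_forests d n m" and ?X = "stable_points d n m :: 'k tup set"
    and ?\<pi> = "orbit (GL d) (GL_act d) :: 'k tup \<Rightarrow> 'k tup set"
    and ?nv = "node_vec n m :: 'k tup \<Rightarrow> nat \<Rightarrow> 'k vec"
    and ?Y = "nc_hilbert d n m :: ('k tup set, 'k) fspace"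
  have cell: "forest_cell d n m S" if "S \<in> ?F" for S
    using nm that by unfold_locales
  have finF: "finite ?F"
    by (rule finite_node_forests[OF nm])
  have sr: "?X \<subseteq> rep_points d n m"
    unfolding stable_points_def by blast
  have v: "?nv x a \<in> carrier_vec d" if "x \<in> ?X" for x a
    using node_vec_carrier[OF nm] that sr by blast
  have "finite (\<Union>?F)"
    using finF unfolding node_forests_def by auto
  then obtain M where M: "\<Union>?F \<subseteq> {..M}"
    using finite_nat_iff_bounded_le by blast
  obtain Ts0 where Ts0: "set Ts0 = ?F" "distinct Ts0"
    using finite_distinct_list[OF finF] by blast
  \<comment> \<open>Lexicographically first forests have the largest weight and must be removed
    first, so the ascending sort is reversed.\<close>
  define Ts where "Ts = rev (sort_key (weight M) Ts0)"
  define u where "u = length Ts"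
  have Ts: "set Ts = ?F" "distinct Ts"
    unfolding Ts_def using Ts0 by auto
  have sorted: "weight M (Ts ! j) \<le> weight M (Ts ! i)" if "i \<le> j" "j < u" for i j
  proof -
    have "sorted (rev (map (weight M) Ts))"
      unfolding Ts_def by (simp add: rev_map)
    then show ?thesis
      using sorted_rev_nth_mono[of "map (weight M) Ts" i j] that unfolding u_def by simp
  qed
  let ?D = "\<lambda>j x. det (family_mat (Ts ! j) (?nv x))"
  have mem: "Ts ! j \<in> ?F" if "j < u" for j
    using Ts(1) nth_mem that unfolding u_def by blast
  \<comment> \<open>By \<open>greedy_lex_first\<close>, any other forest with nonzero determinant
    has strictly smaller weight than the greedy one and so cannot precede it in the list. The greedy
    forest is thus the first entry whose determinant is nonzero.\<close>
  have first: "greedy (?nv x) = Ts ! i \<longleftrightarrow> ?D i x \<noteq> 0 \<and> (\<forall>j<i. ?D j x = 0)"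
    if x: "x \<in> ?X" and i: "i < u" for x i
  proof -
    note gr = greedy_node_vec_forest[OF nm x]
    obtain k where k: "k < u" "greedy (?nv x) = Ts ! k"
      using gr(1) Ts(1) unfolding u_def by (metis in_set_conv_nth)
    have Dk: "?D k x \<noteq> 0"
      using gr(2) k by simp
    have before: "?D j x = 0" if j: "j < k" for j
    proof (rule ccontr)
      assume D: "?D j x \<noteq> 0"
      have ju: "j < u"
        using j k by simp
      have T: "finite (Ts ! j)" "card (Ts ! j) = d"
        using mem[OF ju] unfolding node_forests_def by auto
      have "Ts ! j \<noteq> greedy (?nv x)"
        using k(1) ju j Ts(2) nth_eq_iff_index_eq unfolding k(2) u_def by fastforce
      then obtain s where s: "s \<in> greedy (?nv x)" "s \<notin> Ts ! j"
        and below: "\<forall>t\<in>Ts ! j. t < s \<longrightarrow> t \<in> greedy (?nv x)"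
        using greedy_lex_first[OF v[OF x] T D] by blast
      have "greedy (?nv x) \<subseteq> {..M}" "Ts ! j \<subseteq> {..M}"
        using M gr(1) mem[OF ju] by blast+
      then have "weight M (Ts ! j) < weight M (greedy (?nv x))"
        using weight_less s below by blast
      then show False
        using sorted[of j k] j k by simp
    qed
    show ?thesis
    proof
      assume "greedy (?nv x) = Ts ! i"
      then have "i = k"
        using k i Ts(2) nth_eq_iff_index_eq unfolding u_def by metis
      then show "?D i x \<noteq> 0 \<and> (\<forall>j<i. ?D j x = 0)"
        using Dk before by blast
    next
      assume "?D i x \<noteq> 0 \<and> (\<forall>j<i. ?D j x = 0)"
      then have "i = k"
        using Dk before by (metis linorder_neqE_nat)
      then show "greedy (?nv x) = Ts ! i"
        using k(2) by simp
    qed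
  qed
  have D_orbit: "?D j y = 0 \<longleftrightarrow> ?D j x = 0" if "j < u" "x \<in> ?X" "y \<in> ?X" "?\<pi> x = ?\<pi> y" for j x y
    using forest_cell.det_B_orbit[OF cell[OF mem[OF that(1)]]] that(2-) sr by blast
  \<comment> \<open>Filtration indices start at 1 and list positions at 0: \<open>A i\<close> lets
    the first \<open>i - 1\<close> determinants vanish, so \<open>A 1\<close> imposes no condition
    and \<open>A (u + 1)\<close> imposes all of them.\<close>
  define A where "A i = ?\<pi> ` {x \<in> ?X. \<forall>j. j + 1 < i \<longrightarrow> j < u \<longrightarrow> ?D j x = 0}" for i :: nat
  have mem_A: "?\<pi> x \<in> A i \<longleftrightarrow> (\<forall>j. j + 1 < i \<longrightarrow> j < u \<longrightarrow> ?D j x = 0)" if x: "x \<in> ?X" for x i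
  proof
    assume "?\<pi> x \<in> A i"
    then obtain y where y: "y \<in> ?X" "?\<pi> x = ?\<pi> y" "\<forall>j. j + 1 < i \<longrightarrow> j < u \<longrightarrow> ?D j y = 0"
      unfolding A_def by auto
    then show "\<forall>j. j + 1 < i \<longrightarrow> j < u \<longrightarrow> ?D j x = 0"
      using D_orbit[OF _ x y(1,2)] by blast
  qed (use x in \<open>auto simp: A_def\<close>)
  have A_sub: "A i \<subseteq> ?\<pi> ` ?X" for i
    unfolding A_def by blast
  have topY: "topspace (topo ?Y) = ?\<pi> ` ?X"
    unfolding topspace_nc_hilbert orbits_def by auto
  have mem_diff: "?\<pi> x \<in> A (i + 1) - A (i + 2) \<longleftrightarrow> greedy (?nv x) = Ts ! i"
    if x: "x \<in> ?X" and i: "i < u" for x i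
  proof -
    have "?\<pi> x \<in> A (i + 1) \<longleftrightarrow> (\<forall>j<i. ?D j x = 0)"
      using mem_A[OF x, of "i + 1"] i by auto
    moreover have "?\<pi> x \<in> A (i + 2) \<longleftrightarrow> (\<forall>j<Suc i. ?D j x = 0)"
      using mem_A[OF x, of "i + 2"] i by auto
    ultimately show ?thesis
      unfolding first[OF x i] All_less_Suc by blast
  qed
  have diff: "A (i + 1) - A (i + 2) = forest_cell.cell d n m (Ts ! i)" if i: "i < u" for i
    using mem_diff[OF _ i] A_sub[of "i + 1"] unfolding forest_cell.cell_def[OF cell[OF mem[OF i]]]
    by blast
  \<comment> \<open>The determinants are not invariant, but by \<open>D_orbit\<close> their
    vanishing is; hence they describe the open complement in the quotient.\<close>
  have closed: "closedin (topo ?Y) (A i)" for i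
  proof -
    have "\<forall>j<u. \<exists>p\<in>poly_funs (rep_coords d n m). \<forall>x\<in>rep_points d n m. p x = ?D j x"
      using forest_cell.poly_on_det_B[OF cell[OF mem]] unfolding poly_on_def by blast
    then obtain p where p: "\<And>j. j < u \<Longrightarrow> p j \<in> poly_funs (rep_coords d n m)"
      "\<And>j x. j < u \<Longrightarrow> x \<in> rep_points d n m \<Longrightarrow> p j x = ?D j x"
      by metis
    let ?P = "p ` {j. j + 1 < i \<and> j < u}"
    have "?\<pi> x \<in> ?\<pi> ` ?X - A i \<longleftrightarrow> (\<exists>q\<in>?P. q x \<noteq> 0)" if x: "x \<in> ?X" for x
    proof -
      have "x \<in> rep_points d n m"
        using x sr by blast
      then have "(\<exists>q\<in>?P. q x \<noteq> 0) \<longleftrightarrow> (\<exists>j. j + 1 < i \<and> j < u \<and> ?D j x \<noteq> 0)"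
        by (simp add: p(2) Bex_def image_iff) (metis p(2))
      then show ?thesis
        using mem_A[OF x, of i] x by blast
    qed
    moreover have "?P \<subseteq> poly_funs (rep_coords d n m)"
      using p(1) by auto
    ultimately have "openin (topo ?Y) (?\<pi> ` ?X - A i)"
      unfolding nc_hilbert_def rep_space_def openin_quotient_induced_zariski[OF sr]
      by (intro conjI exI[of _ ?P] ballI Diff_subset)
    then show ?thesis
      unfolding closedin_def topY using A_sub by blast
  qed
  have "cell_decomposition ?Y u A"
    unfolding cell_decomposition_def
  proof (intro conjI ballI)
    show "A 1 = topspace (topo ?Y)"
      unfolding topY A_def by simp
    have "\<exists>j<u. ?D j x \<noteq> 0" if x: "x \<in> ?X" for x
      using greedy_node_vec_forest[OF nm x] Ts(1) unfolding u_def by (metis in_set_conv_nth)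
    then show "A (u + 1) = {}"
      unfolding A_def by force
    show "closedin (topo ?Y) (A i)" for i
      by (rule closed)
    fix i assume i: "i \<in> {1..u}"
    show "A (i + 1) \<subseteq> A i"
      unfolding A_def by (intro image_mono) auto
    have i': "i - 1 < u"
      using i by auto
    have "A i - A (i + 1) = forest_cell.cell d n m (Ts ! (i - 1))"
      using diff[OF i'] i by simp
    then show "\<exists>N. isomorphic_fspaces (induced_fspace ?Y (A i - A (i + 1))) (affine_space N :: ('k vec, 'k) fspace)"
      using forest_cell.cell_affine_space[OF cell[OF mem[OF i']]] by auto
  qed
  moreover have "bij_betw (\<lambda>S. forest_cell.cell d n m S :: 'k tup set set) ?F (cells u A)"
    unfolding bij_betw_def
  proof
    show "inj_on (\<lambda>S. forest_cell.cell d n m S :: 'k tup set set) ?F"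
    proof (rule inj_onI)
      fix S T assume S: "S \<in> ?F" and T: "T \<in> ?F"
        and eq: "forest_cell.cell d n m S = (forest_cell.cell d n m T :: 'k tup set set)"
      obtain i j where ij: "i < u" "S = Ts ! i" "j < u" "T = Ts ! j"
        using S T Ts(1) unfolding u_def by (metis in_set_conv_nth)
      \<comment> \<open>Distinct forests give distinct cells because a point of the cell has a
        unique greedy forest and each cell contains a normal form. The facts about normal forms hold
        for every argument, so the empty vector serves as witness.\<close>
      let ?x = "forest_cell.normal_form d n m S (0\<^sub>v 0) :: 'k tup"
      have "?\<pi> ?x \<in> A (j + 1) - A (j + 2)"
        unfolding diff[OF ij(3)] ij(4)[symmetric] eq[symmetric]
        by (rule forest_cell.normal_form_cell[OF cell[OF S]])
      then show "S = T"
        using mem_diff[OF forest_cell.normal_form_stable[OF cell[OF S]] ij(3)]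
          forest_cell.greedy_normal_form[OF cell[OF S]] ij(4) by metis
    qed
    have "cells u A = (\<lambda>i. A i - A (i + 1)) ` Suc ` {..<u}"
      unfolding cells_def image_Suc_lessThan by auto
    also have "\<dots> = (\<lambda>i. forest_cell.cell d n m (Ts ! i)) ` {..<u}"
      unfolding image_image by (intro image_cong) (simp_all flip: diff)
    also have "\<dots> = (\<lambda>S. forest_cell.cell d n m S) ` ?F"
      unfolding Ts(1)[symmetric] u_def set_conv_nth by auto
    finally show "(\<lambda>S. forest_cell.cell d n m S) ` ?F = cells u A" ..
  qed
  then have "bij_betw ((\<lambda>S. forest_cell.cell d n m S :: 'k tup set set) \<circ> forest_code n m)
      (forests d n m) (cells u A)"
    by (rule bij_betw_trans[OF bij_forest_code[OF nm]])
  ultimately show ?thesis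
    by blast
qed

end
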